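(* Define $S\in L^2(\mathbb{H})$ by $$ S(p,q,t) = \begin{cases} 0 & \text{for } |p|>1,\\[4pt] \dfrac14\left[\left(\dfrac{t}{q}+\dfrac{1-|p|}{2}\right)\mathrm{sinc}^2\!\left(\dfrac t2+\dfrac{1-|p|}{4}q\right) - \left(\dfrac{t}{q}-\dfrac{1-|p|}{2}\right)\mathrm{sinc}^2\!\left(\dfrac t2-\dfrac{1-|p|}{4}q\right)\right] & \text{for } |p|\le1,\ q\neq0,\\[8pt] \dfrac{1-|p|}{4}\left(2\,\mathrm{sinc}(t)-\mathrm{sinc}^2(t/2)\right) & \text{for } |p|\le1,\ q=0.\end{cases} $$ Let $\mathcal{H}\subset L^2(\mathbb{H})$ be the left-invariant closed subspace generated by $S$. Then $\mathcal{H}$ is a sampling space for the lattice $\Gamma_1$, with $c_{\mathcal{H}}=1$, and $S$ is the associated sinc-type function. Moreover $\lambda_{\mathbb{H}}(\Gamma_1)S = (\lambda_{\mathbb{H}}(\gamma)S)_{\gamma\in\Gamma_1}$ is a normalised tight frame, but not an orthonormal basis, of $\mathcal{H}$, because $\|S\|_2=\frac12$.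
   Context: Heisenberg group: $\mathbb{H} = \mathbb{R}^3$ with product $(p,q,t)(p',q',t') = (p+p', q+q', t+t'+(pq'-qp')/2)$, Lebesgue measure as Haar measure. $\lambda_{\mathbb{H}}$ is the left regular representation, $(\lambda_{\mathbb{H}}(x)f)(y) = f(x^{-1}y)$. $\mathrm{sinc}(x) = \frac{\sin(\pi x)}{\pi x}$ (with $\mathrm{sinc}(0)=1$). The lattice $\Gamma_1$ is $\{(m,k,\ell+\frac12mk): m,k,\ell\in\mathbb{Z}\}$. The left-invariant closed subspace generated by $S$ is the closed linear span of $\{\lambda_{\mathbb{H}}(x)S: x\in\mathbb{H}\}$. Sampling space: a closed left-invariant subspace $\mathcal{H}\subset L^2(\mathbb{H})$ consisting of continuous functions is a sampling space with respect to $\Gamma\subset\mathbb{H}$ if (i) there is a constant $c_{\mathcal{H}}>0$ with $\sum_{\gamma\in\Gamma}|f(\gamma)|^2 = c_{\mathcal{H}}\|f\|_2^2$ for all $f\in\mathcal{H}$; and (ii) there exists $S\in\mathcal{H}$ such that every $f\in\mathcal{H}$ has the expansion $f(x) = \sum_{\gamma\in\Gamma} f(\gamma)S(\gamma^{-1}x)$, with convergence both in $L^2$ and uniformly. The function $S$ in (ii) is called a sinc-type function. A family $(\eta_i)_{i\in I}$ in a Hilbert space $\mathcal{K}$ is a normalised tight frame if $\sum_i|\langle\varphi,\eta_i\rangle|^2 = \|\varphi\|^2$ for all $\varphi\in\mathcal{K}$. *)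

theory Defs
  imports "HOL-Analysis.Analysis" "HOL-Library.Function_Algebras"
begin

section \<open>The Heisenberg group\<close>

type_synonym heis = "real \<times> real \<times> real"

fun heis_mult :: "heis \<Rightarrow> heis \<Rightarrow> heis" where
  "heis_mult (p, q, t) (p', q', t') = (p + p', q + q', t + t' + (p * q' - q * p') / 2)"

fun heis_inv :: "heis \<Rightarrow> heis" where
  "heis_inv (p, q, t) = (- p, - q, - t)"

lemma heis_mult_assoc: "heis_mult (heis_mult x y) z = heis_mult x (heis_mult y z)"
  by (cases x; cases y; cases z) (simp add: field_simps)

lemma heis_mult_unit: "heis_mult (0, 0, 0) x = x" "heis_mult x (0, 0, 0) = x"
  by (cases x; simp)+

lemma heis_mult_inv: "heis_mult (heis_inv x) x = (0, 0, 0)" "heis_mult x (heis_inv x) = (0, 0, 0)"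
  by (cases x; simp)+

definition heis_lattice :: "heis set" where
  "heis_lattice =
    {(real_of_int m, real_of_int k, real_of_int l + real_of_int m * real_of_int k / 2) | m k l. True}"

definition lreg :: "heis \<Rightarrow> (heis \<Rightarrow> complex) \<Rightarrow> (heis \<Rightarrow> complex)" where
  "lreg x f = (\<lambda>y. f (heis_mult (heis_inv x) y))"


section \<open>Square-integrable functions\<close>

text \<open>
  Elements of \<open>L\<^sup>2\<close> are represented by functions; two functions represent the same element
  iff they agree almost everywhere, i.e. iff their difference has norm \<open>0\<close>.  Subspaces of
  \<open>L\<^sup>2\<close> are represented by sets of functions.  A closed set (\<open>L2_closure H = H\<close>)
  contains with each function all other representatives of the same element of \<open>L\<^sup>2\<close>.
\<close>

definition L2 :: "(heis \<Rightarrow> complex) set" where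
  "L2 = {f \<in> borel_measurable lborel. integrable lborel (\<lambda>x. (cmod (f x))\<^sup>2)}"

definition L2_inner :: "(heis \<Rightarrow> complex) \<Rightarrow> (heis \<Rightarrow> complex) \<Rightarrow> complex" where
  "L2_inner f g = (LINT x|lborel. f x * cnj (g x))"

definition L2_norm :: "(heis \<Rightarrow> complex) \<Rightarrow> real" where
  "L2_norm f = sqrt (LINT x|lborel. (cmod (f x))\<^sup>2)"

definition L2_closure :: "(heis \<Rightarrow> complex) set \<Rightarrow> (heis \<Rightarrow> complex) set" where
  "L2_closure A = {f \<in> L2. \<forall>\<epsilon>>0. \<exists>g\<in>A. L2_norm (f - g) < \<epsilon>}"

text \<open>The complex linear structure on functions, with pointwise operations; this provides
  \<open>cfun.subspace\<close> and \<open>cfun.span\<close>.\<close>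

global_interpretation cfun: vector_space "\<lambda>(c::complex) (f :: heis \<Rightarrow> complex) x. c * f x"
  by standard (auto simp: fun_eq_iff algebra_simps)

definition closed_left_invariant_subspace :: "(heis \<Rightarrow> complex) set \<Rightarrow> bool" where
  "closed_left_invariant_subspace H \<longleftrightarrow>
     H \<subseteq> L2 \<and> cfun.subspace H \<and> L2_closure H = H \<and> (\<forall>x. \<forall>f\<in>H. lreg x f \<in> H)"

definition left_invariant_generated :: "(heis \<Rightarrow> complex) \<Rightarrow> (heis \<Rightarrow> complex) set" where
  "left_invariant_generated S = L2_closure (cfun.span (range (\<lambda>x. lreg x S)))"


section \<open>Sampling spaces\<close>

text \<open>
  Every element of \<open>L\<^sup>2\<close> has at most one continuous representative, and point evaluations
  refer to that representative.  Sums over the sampling set are unordered: limits along the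
  net of finite subsets.
\<close>

definition cont_rep :: "(heis \<Rightarrow> complex) set \<Rightarrow> (heis \<Rightarrow> complex) set" where
  "cont_rep H = {f \<in> H. continuous_on UNIV f}"

definition consists_of_continuous :: "(heis \<Rightarrow> complex) set \<Rightarrow> bool" where
  "consists_of_continuous H \<longleftrightarrow> (\<forall>f\<in>H. \<exists>g\<in>cont_rep H. AE x in lborel. f x = g x)"

definition sampling_identity :: "heis set \<Rightarrow> (heis \<Rightarrow> complex) set \<Rightarrow> real \<Rightarrow> bool" where
  "sampling_identity \<Gamma> H c \<longleftrightarrow>
     c > 0 \<and> (\<forall>f\<in>cont_rep H. ((\<lambda>\<gamma>. (cmod (f \<gamma>))\<^sup>2) has_sum (c * (L2_norm f)\<^sup>2)) \<Gamma>)"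

definition sinc_type_function ::
    "heis set \<Rightarrow> (heis \<Rightarrow> complex) set \<Rightarrow> (heis \<Rightarrow> complex) \<Rightarrow> bool" where
  "sinc_type_function \<Gamma> H S \<longleftrightarrow>
     S \<in> cont_rep H \<and>
     (\<forall>f\<in>cont_rep H.
        ((\<lambda>F. L2_norm (\<lambda>x. f x - (\<Sum>\<gamma>\<in>F. f \<gamma> * S (heis_mult (heis_inv \<gamma>) x)))) \<longlongrightarrow> 0)
          (finite_subsets_at_top \<Gamma>) \<and>
        uniform_limit UNIV (\<lambda>F x. \<Sum>\<gamma>\<in>F. f \<gamma> * S (heis_mult (heis_inv \<gamma>) x)) f
          (finite_subsets_at_top \<Gamma>))"

definition sampling_space :: "heis set \<Rightarrow> (heis \<Rightarrow> complex) set \<Rightarrow> bool" where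
  "sampling_space \<Gamma> H \<longleftrightarrow>
     closed_left_invariant_subspace H \<and> consists_of_continuous H \<and>
     (\<exists>c. sampling_identity \<Gamma> H c) \<and> (\<exists>S. sinc_type_function \<Gamma> H S)"


section \<open>Frames and bases of closed subspaces\<close>

definition normalised_tight_frame ::
    "'i set \<Rightarrow> ('i \<Rightarrow> heis \<Rightarrow> complex) \<Rightarrow> (heis \<Rightarrow> complex) set \<Rightarrow> bool" where
  "normalised_tight_frame I \<eta> K \<longleftrightarrow>
     (\<forall>i\<in>I. \<eta> i \<in> K) \<and>
     (\<forall>\<phi>\<in>K. ((\<lambda>i. (cmod (L2_inner \<phi> (\<eta> i)))\<^sup>2) has_sum (L2_norm \<phi>)\<^sup>2) I)"

definition orthonormal_basis ::
    "'i set \<Rightarrow> ('i \<Rightarrow> heis \<Rightarrow> complex) \<Rightarrow> (heis \<Rightarrow> complex) set \<Rightarrow> bool" where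
  "orthonormal_basis I \<eta> K \<longleftrightarrow>
     (\<forall>i\<in>I. \<eta> i \<in> K) \<and>
     (\<forall>i\<in>I. \<forall>j\<in>I. L2_inner (\<eta> i) (\<eta> j) = (if i = j then 1 else 0)) \<and>
     L2_closure (cfun.span (\<eta> ` I)) = K"


section \<open>The function \<open>S\<close>\<close>

definition nsinc :: "real \<Rightarrow> real" where
  "nsinc x = (if x = 0 then 1 else sin (pi * x) / (pi * x))"

fun heis_sinc :: "heis \<Rightarrow> complex" where
  "heis_sinc (p, q, t) = complex_of_real
    (if \<bar>p\<bar> > 1 then 0
     else if q \<noteq> 0 then
       1/4 * ((t / q + (1 - \<bar>p\<bar>) / 2) * (nsinc (t / 2 + (1 - \<bar>p\<bar>) / 4 * q))\<^sup>2
              - (t / q - (1 - \<bar>p\<bar>) / 2) * (nsinc (t / 2 - (1 - \<bar>p\<bar>) / 4 * q))\<^sup>2)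
     else (1 - \<bar>p\<bar>) / 4 * (2 * nsinc t - (nsinc (t / 2))\<^sup>2))"

end

theory Submission
  imports Defs
begin

text \<open>
  Taking the Fourier transform in the central variable, \<open>S(p,q,t)\<close> becomes
  \<open>\<integral>\<bar>h\<bar> e\<^bsup>2\<pi>iht\<^esup> \<langle>\<chi>, \<rho>\<^sub>h(p,q) \<chi>\<rangle> dh\<close> over \<open>\<bar>h\<bar> \<le> 1/2\<close>, where \<open>\<chi>\<close> is the indicator function of
  the unit interval and \<open>\<rho>\<^sub>h\<close> the Schroedinger representation. For a lattice point \<open>(m, k, l + mk/2)\<close> the sum
  over \<open>l\<close> is Parseval's identity in \<open>h\<close>; for fixed \<open>h\<close> the sum over \<open>k\<close> is Parseval's identity on an
  interval of length \<open>\<bar>h\<bar> \<le> 1\<close>, which yields the factor \<open>1/\<bar>h\<bar>\<close> and hence the Plancherel weight; the sum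
  over \<open>m\<close> covers the line by unit intervals. This gives
  \<open>\<Sum>\<^sub>\<gamma> S(x\<inverse>\<gamma>) S(y\<inverse>\<gamma>) = S(x\<inverse>y)\<close> for all \<open>x\<close>, \<open>y\<close>. Since right translates of a unit cube by the
  lattice tile the group, averaging over the cube gives the same identity with the integral over the group in
  place of the sum. So \<open>S\<close> is a reproducing kernel and the lattice translates satisfy the tight frame identity
  on finite linear combinations of translates; both extend to the closed span by density, and
  \<open>\<bar>f(x)\<bar> \<le> \<parallel>f\<parallel> \<parallel>S\<parallel>\<close> turns convergence in \<open>L\<^sup>2\<close> into uniform convergence.
\<close>

section \<open>Fourier series of bounded functions\<close>

text \<open>The offset mk/2 of the lattice makes the three summations separate: at u + m the
  exponent of the lattice point (m, k, l + mk/2) is l - k u, because the two halves of mk cancel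
  against k m. Thus l is dual to h, k is dual to h u, and m only moves the unit interval. The band
  |h| <= 1/2 has length one, the period dual to the integers l. In contrast, h u runs through an
  interval of length |h| < 1, on which the exponentials in k are overcomplete: this is the source of
  a tight frame that is not orthonormal. The squared norm of S is the mass 1/4 of |h| on the band.
  Elements of L2 have no point values, so Bessel's inequality and the tight frame identity are
  stated for the inner products of f with the translates of S; these are identified with the values
  of the continuous representative of f afterwards. As every identity is established for translates
  of S first, the Fourier analysis concerns bounded functions on a unit interval.\<close>

definition unit_char :: "real \<Rightarrow> complex" where
  "unit_char x = cis (2 * pi * x)"

lemma unit_char_add: "unit_char (x + y) = unit_char x * unit_char y"
  by (simp add: unit_char_def cis_mult algebra_simps)

lemma unit_char_minus: "unit_char (- x) = cnj (unit_char x)"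
  by (simp add: unit_char_def cis_cnj)

lemma norm_unit_char [simp]: "cmod (unit_char x) = 1"
  by (simp add: unit_char_def)

lemma unit_char_0 [simp]: "unit_char 0 = 1"
  by (simp add: unit_char_def)

lemma unit_char_of_int [simp]: "unit_char (of_int k) = 1"
proof -
  have "2 * pi * of_int k = 2 * of_int k * pi" by simp
  then show ?thesis
    unfolding unit_char_def by (metis cis_multiple_2pi Ints_of_int mult.assoc mult.commute)
qed

lemma continuous_on_unit_char [continuous_intros]:
  "continuous_on A f \<Longrightarrow> continuous_on A (\<lambda>x. unit_char (f x))"
  unfolding unit_char_def by (intro continuous_intros)

lemma borel_measurable_unit_char [measurable]: "unit_char \<in> borel_measurable borel"
  by (intro borel_measurable_continuous_onI continuous_intros)

lemma borel_measurable_cnj [measurable]: "cnj \<in> borel_measurable borel"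
  by (intro borel_measurable_continuous_onI continuous_intros)

text \<open>Kept as a measure on all of R so that integrands remain total functions. It serves for
  the frequency h, for the variable u and for each coordinate of the unit cube; half-openness makes
  the integer translates disjoint.\<close>

definition cell :: "real measure" where
  "cell = density lborel (\<lambda>x. ennreal (indicator {-1/2..<1/2} x))"

lemma sets_cell [simp, measurable_cong]: "sets cell = sets borel"
  by (simp add: cell_def)

lemma space_cell [simp]: "space cell = UNIV"
  by (simp add: cell_def)

lemma nn_integral_cell:
  assumes [measurable]: "f \<in> borel_measurable borel"
  shows "(\<integral>\<^sup>+ x. f x \<partial>cell) = (\<integral>\<^sup>+ x. indicator {-1/2..<1/2} x * f x \<partial>lborel)"
  unfolding cell_def by (subst nn_integral_density) (auto simp: ennreal_indicator)

lemma integral_cell: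
  fixes f :: "real \<Rightarrow> 'b :: {banach, second_countable_topology}"
  assumes [measurable]: "f \<in> borel_measurable borel"
  shows "(\<integral> x. f x \<partial>cell) = (\<integral> x. indicator {-1/2..<1/2} x *\<^sub>R f x \<partial>lborel)"
  unfolding cell_def by (subst integral_density) auto

lemma emeasure_cell_UNIV [simp]: "emeasure cell UNIV = 1"
  by (simp add: cell_def emeasure_density ennreal_indicator)

global_interpretation cell: finite_measure cell
  by (rule finite_measureI) simp

lemma measure_cell_UNIV [simp]: "measure cell UNIV = 1"
  by (simp add: measure_def)

text \<open>Discards the left endpoint, where the cut-offs used below vanish and where the argument
  function has its cut.\<close>

lemma AE_cell: "AE x in cell. x \<in> {-1/2<..<1/2}"
proof -
  have "AE x in lborel. x \<noteq> (-1/2 :: real)" by (rule AE_lborel_singleton)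
  then show ?thesis
    unfolding cell_def
    by (subst AE_density) (auto elim!: eventually_mono simp: indicator_def split: if_splits)
qed

lemma AE_cellI:
  assumes "AE x in lborel. P x"
  shows "AE x in cell. P x"
  unfolding cell_def using assms by (subst AE_density) (auto elim!: eventually_mono)

lemma integrable_cell_bounded:
  fixes f :: "real \<Rightarrow> 'b :: {banach, second_countable_topology}"
  assumes "f \<in> borel_measurable borel" "\<And>x. norm (f x) \<le> B"
  shows "integrable cell f"
  by (rule cell.integrable_const_bound[where B = B])
    (use assms in \<open>auto simp: measurable_cong_sets[OF sets_cell refl]\<close>)

lemma integral_cell_FTC:
  fixes f :: "real \<Rightarrow> 'b :: euclidean_space"
  assumes "\<And>x. (F has_vector_derivative f x) (at x)" and f: "continuous_on UNIV f"
  shows "(\<integral> x. f x \<partial>cell) = F (1/2) - F (-1/2)"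
proof -
  have [measurable]: "f \<in> borel_measurable borel"
    using f by (rule borel_measurable_continuous_onI)
  have "(\<integral> x. f x \<partial>cell) = (\<integral> x. indicator {-1/2..<1/2} x *\<^sub>R f x \<partial>lborel)"
    by (rule integral_cell) simp
  also have "\<dots> = (\<integral> x. indicator {-1/2..1/2} x *\<^sub>R f x \<partial>lborel)"
  proof (rule integral_cong_AE)
    have "AE x in lborel. x \<noteq> (1/2 :: real)" by (rule AE_lborel_singleton)
    then show "AE x in lborel. indicator {-1/2..<1/2} x *\<^sub>R f x = indicator {-1/2..1/2} x *\<^sub>R f x"
      by eventually_elim (auto simp: indicator_def)
  qed auto
  also have "\<dots> = F (1/2) - F (-1/2)"
    by (rule integral_FTC_Icc)
      (auto intro: has_vector_derivative_at_within assms(1) continuous_on_subset[OF f])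
  finally show ?thesis .
qed

lemma unit_char_has_vector_derivative:
  "((\<lambda>x. unit_char (c * x)) has_vector_derivative (2 * pi * c * \<i>) * unit_char (c * x)) (at x)"
proof -
  have "((\<lambda>z. exp (2 * pi * c * \<i> * z)) has_field_derivative
      2 * pi * c * \<i> * exp (2 * pi * c * \<i> * of_real x)) (at (of_real x))"
    by (auto intro!: derivative_eq_intros)
  from has_vector_derivative_real_field[OF this] show ?thesis
    by (simp add: unit_char_def cis_conv_exp mult_ac)
qed

lemma integral_cell_unit_char: "(\<integral> x. unit_char (of_int k * x) \<partial>cell) = (if k = 0 then 1 else 0)"
proof (cases "k = 0")
  case False
  define F where "F = (\<lambda>x. unit_char (of_int k * x) / (2 * pi * of_int k * \<i>))"
  have "(\<integral> x. unit_char (of_int k * x) \<partial>cell) = F (1/2) - F (-1/2)"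
  proof (rule integral_cell_FTC)
    fix x
    show "(F has_vector_derivative unit_char (of_int k * x)) (at x)"
      unfolding F_def
      by (rule has_vector_derivative_eq_rhs,
          rule has_vector_derivative_divide[OF unit_char_has_vector_derivative]) (use False in auto)
  qed (intro continuous_intros)
  also have "unit_char (of_int k * (1/2)) = unit_char (of_int k * (-1/2))"
    using unit_char_add[of "of_int k" "of_int k * (-1/2)"] by (simp add: field_simps)
  then have "F (1/2) - F (-1/2) = 0"
    unfolding F_def by simp
  finally show ?thesis using False by simp
qed simp

lemma integral_cell_unit_char_orthonormal:
  "(\<integral> x. unit_char (of_int j * x) * cnj (unit_char (of_int k * x)) \<partial>cell) = (if j = k then 1 else 0)"
  using integral_cell_unit_char[of "j - k"]
  by (simp flip: unit_char_minus unit_char_add add: algebra_simps)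

section \<open>Trigonometric polynomials and their density\<close>

inductive trig_poly :: "(real \<Rightarrow> complex) \<Rightarrow> bool" where
  monom: "trig_poly (\<lambda>x. c * unit_char (of_int k * x))"
| add: "trig_poly f \<Longrightarrow> trig_poly g \<Longrightarrow> trig_poly (\<lambda>x. f x + g x)"

lemma trig_poly_const: "trig_poly (\<lambda>x. c)"
  using trig_poly.monom[of c 0] by simp

lemma trig_poly_monom_mult: "trig_poly g \<Longrightarrow> trig_poly (\<lambda>x. c * unit_char (of_int k * x) * g x)"
proof (induction rule: trig_poly.induct)
  case (monom d l)
  have "(\<lambda>x. c * unit_char (of_int k * x) * (d * unit_char (of_int l * x))) =
        (\<lambda>x. (c * d) * unit_char (of_int (k + l) * x))"
    by (auto simp: fun_eq_iff unit_char_add ring_distribs)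
  then show ?case using trig_poly.monom by metis
next
  case (add f g)
  then show ?case by (simp add: ring_distribs trig_poly.add)
qed

lemma trig_poly_mult: "trig_poly f \<Longrightarrow> trig_poly g \<Longrightarrow> trig_poly (\<lambda>x. f x * g x)"
proof (induction rule: trig_poly.induct)
  case (add f1 f2)
  then show ?case by (simp add: ring_distribs trig_poly.add)
qed (rule trig_poly_monom_mult)

lemma trig_poly_cos: "trig_poly (\<lambda>x. of_real (cos (2 * pi * x)))"
  and trig_poly_sin: "trig_poly (\<lambda>x. of_real (sin (2 * pi * x)))"
proof -
  have "trig_poly (\<lambda>x. (1/2) * unit_char (of_int 1 * x) + (1/2) * unit_char (of_int (-1) * x))"
    by (intro trig_poly.intros)
  also have "(\<lambda>x. (1/2) * unit_char (of_int 1 * x) + (1/2) * unit_char (of_int (-1) * x))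
      = (\<lambda>x. of_real (cos (2 * pi * x)))"
    by (simp add: fun_eq_iff unit_char_def complex_eq_iff)
  finally show "trig_poly (\<lambda>x. of_real (cos (2 * pi * x)))" .
  have "trig_poly (\<lambda>x. (-\<i>/2) * unit_char (of_int 1 * x) + (\<i>/2) * unit_char (of_int (-1) * x))"
    by (intro trig_poly.intros)
  also have "(\<lambda>x. (-\<i>/2) * unit_char (of_int 1 * x) + (\<i>/2) * unit_char (of_int (-1) * x))
      = (\<lambda>x. of_real (sin (2 * pi * x)))"
    by (simp add: fun_eq_iff unit_char_def complex_eq_iff)
  finally show "trig_poly (\<lambda>x. of_real (sin (2 * pi * x)))" .
qed

text \<open>Stone-Weierstrass delivers polynomials in the real coordinates of a point of the circle.
  A real-linear functional pulls back to a combination of cosine and sine; the other rules of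
  \<open>real_polynomial_function\<close> are closure properties of trigonometric
  polynomials.\<close>

lemma trig_poly_real_polynomial_function:
  fixes p :: "complex \<Rightarrow> real"
  assumes "real_polynomial_function p"
  shows "trig_poly (\<lambda>x. of_real (p (unit_char x)))"
  using assms
proof (induction rule: real_polynomial_function.induct)
  case (linear f)
  interpret bounded_linear f by fact
  have f: "f (unit_char x) = cos (2 * pi * x) * f 1 + sin (2 * pi * x) * f \<i>" for x
  proof -
    have "unit_char x = cos (2 * pi * x) *\<^sub>R 1 + sin (2 * pi * x) *\<^sub>R \<i>"
      by (simp add: unit_char_def complex_eq_iff)
    then show ?thesis by (simp only: add scaleR) simp
  qed
  show ?case
    unfolding f of_real_add of_real_mult
    by (intro trig_poly.add trig_poly_mult trig_poly_cos trig_poly_sin trig_poly_const)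
next
  case (mult f g)
  then show ?case by (simp add: trig_poly_mult)
qed (simp_all add: trig_poly_const trig_poly.add)

lemma trig_poly_polynomial_function:
  fixes p :: "complex \<Rightarrow> complex"
  assumes "polynomial_function p"
  shows "trig_poly (\<lambda>x. p (unit_char x))"
proof -
  have "trig_poly (\<lambda>x. of_real ((Re \<circ> p) (unit_char x)))" "trig_poly (\<lambda>x. of_real ((Im \<circ> p) (unit_char x)))"
    using assms bounded_linear_Re bounded_linear_Im unfolding polynomial_function_def
    by (blast intro: trig_poly_real_polynomial_function)+
  then have "trig_poly (\<lambda>x. of_real (Re (p (unit_char x))) + \<i> * of_real (Im (p (unit_char x))))"
    by (intro trig_poly.add trig_poly_mult trig_poly_const) simp_all
  then show ?thesis by (simp flip: complex_eq)
qed

lemma trig_poly_obtain_coeffs: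
  assumes "trig_poly P"
  obtains K c where "finite K" "P = (\<lambda>x. \<Sum>k\<in>K. c k * unit_char (of_int k * x))"
proof -
  have "\<exists>K c. finite K \<and> P = (\<lambda>x. \<Sum>k\<in>K. c k * unit_char (of_int k * x))"
    using assms
  proof induction
    case (monom c k)
    show ?case by (intro exI[of _ "{k}"] exI[of _ "\<lambda>_. c"]) simp
  next
    case (add f g)
    then obtain K c L d where *: "finite K" "finite L"
      "f = (\<lambda>x. \<Sum>k\<in>K. c k * unit_char (of_int k * x))"
      "g = (\<lambda>x. \<Sum>k\<in>L. d k * unit_char (of_int k * x))" by blast
    let ?c = "\<lambda>k. (if k \<in> K then c k else 0) + (if k \<in> L then d k else 0)"
    have "(\<Sum>k\<in>K. c k * unit_char (of_int k * x)) =
        (\<Sum>k\<in>K \<union> L. (if k \<in> K then c k else 0) * unit_char (of_int k * x))"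
      and "(\<Sum>k\<in>L. d k * unit_char (of_int k * x)) =
        (\<Sum>k\<in>K \<union> L. (if k \<in> L then d k else 0) * unit_char (of_int k * x))" for x
      using * by (auto intro!: sum.mono_neutral_cong_left)
    then have "(\<lambda>x. f x + g x) = (\<lambda>x. \<Sum>k\<in>K \<union> L. ?c k * unit_char (of_int k * x))"
      using * by (simp add: ring_distribs sum.distrib)
    then show ?case using * by (intro exI[of _ "K \<union> L"] exI[of _ ?c]) auto
  qed
  then show ?thesis using that by blast
qed

text \<open>Transport to the circle, where a function vanishing near the cut of \<^term>\<open>Arg\<close> stays continuous.\<close>

lemma trig_poly_uniform_approx:
  fixes g :: "real \<Rightarrow> complex"
  assumes g: "continuous_on UNIV g" and "d > 0" and d: "\<And>x. \<bar>x\<bar> \<ge> 1/2 - d \<Longrightarrow> g x = 0" and "e > 0"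
  obtains P where "trig_poly P" "\<And>x. x \<in> {-1/2<..<1/2} \<Longrightarrow> cmod (g x - P x) < e"
proof -
  define G where "G = (\<lambda>z. g (Arg z / (2 * pi)))"
  have "continuous (at z within sphere 0 1) G" if z: "z \<in> sphere 0 1" for z
  proof (cases "z \<in> \<real>\<^sub>\<le>\<^sub>0")
    case False
    have c1: "continuous (at z within sphere 0 1) (\<lambda>z. Arg z / (2 * pi))"
      by (intro continuous_intros continuous_within_Arg False) auto
    have c2: "isCont g (Arg z / (2 * pi))" using g by (simp add: continuous_on_eq_continuous_at)
    show ?thesis
      unfolding G_def by (rule continuous_within_compose3[OF c2 c1])
  next
    case True
    \<comment> \<open>The angular half-width of an arc about -1 on which \<open>G\<close>
      vanishes.\<close>
    define r where "r = 2 * pi * d"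
    have "r > 0" using \<open>d > 0\<close> by (simp add: r_def)
    have "Im z = 0" "Re z \<le> 0" using True by (auto simp: complex_nonpos_Reals_iff)
    moreover have "cmod z = 1" using z by simp
    ultimately have "z = -1" by (simp add: complex_eq_iff cmod_eq_Re)
    \<comment> \<open>The minimum with 1 keeps the angle inside [0, pi], where cosine decreases, so
      that a bound on the real part becomes a bound on the angle.\<close>
    have "\<forall>\<^sub>F w in at z within sphere 0 1. Re w < cos (pi - min r 1)"
    proof -
      have "cos (pi - min r 1) > cos pi"
        using \<open>r > 0\<close> pi_gt3 by (intro cos_monotone_0_pi) auto
      then have "Re z < cos (pi - min r 1)" using \<open>z = -1\<close> by simp
      moreover have "((\<lambda>w. Re w) \<longlongrightarrow> Re z) (at z within sphere 0 1)" by (intro tendsto_intros)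
      ultimately show ?thesis by (rule order_tendstoD(2)[rotated])
    qed
    then have "\<forall>\<^sub>F w in at z within sphere 0 1. G w = 0"
      unfolding eventually_at_filter
    proof eventually_elim
      case (elim w)
      show ?case
      proof (intro impI)
        assume "w \<noteq> z" "w \<in> sphere 0 1"
        then have w: "Re w < cos (pi - min r 1)" "cmod w = 1" using elim by auto
        have "Re (rcis (cmod w) (Arg w)) = cos (Arg w)" using w by simp
        then have "Re w = cos (Arg w)" by (simp only: rcis_cmod_Arg)
        then have "cos \<bar>Arg w\<bar> < cos (pi - min r 1)" using w by simp
        moreover have "\<bar>Arg w\<bar> \<le> pi" using Arg_bounded[of w] by auto
        moreover have "cos (pi - min r 1) \<le> cos \<bar>Arg w\<bar>" if "\<bar>Arg w\<bar> \<le> pi - min r 1"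
          by (rule cos_monotone_0_pi_le) (use that \<open>r > 0\<close> in auto)
        ultimately have "\<bar>Arg w\<bar> > pi - min r 1" by linarith
        then have "\<bar>Arg w\<bar> \<ge> pi - r" by linarith
        then have "\<bar>Arg w / (2 * pi)\<bar> \<ge> 1/2 - d"
          by (simp add: r_def field_simps)
        then show "G w = 0" unfolding G_def by (rule d)
      qed
    qed
    moreover have "G z = 0"
      unfolding G_def using \<open>z = -1\<close> \<open>d > 0\<close> using Arg_cis[of pi] by (intro d) simp
    ultimately show ?thesis
      unfolding continuous_within by (simp add: tendsto_eventually)
  qed
  then have "continuous_on (sphere 0 1) G" by (simp add: continuous_on_eq_continuous_within)
  from Stone_Weierstrass_polynomial_function[OF compact_sphere this \<open>e > 0\<close>]
  obtain p where p: "polynomial_function p" "\<And>z. z \<in> sphere 0 1 \<Longrightarrow> cmod (G z - p z) < e" by blast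
  show ?thesis
  proof
    show "trig_poly (\<lambda>x. p (unit_char x))" using p(1) by (rule trig_poly_polynomial_function)
    fix x :: real assume "x \<in> {-1/2<..<1/2}"
    then have "2 * x < 1" "-1 < 2 * x" by auto
    from this[THEN mult_strict_left_mono, OF pi_gt_zero] have "2 * pi * x \<in> {-pi<..pi}" by (simp only: greaterThanAtMost_iff) linarith
    then have "Arg (unit_char x) = 2 * pi * x"
      unfolding unit_char_def by (rule Arg_cis)
    then have "G (unit_char x) = g x" by (simp add: G_def)
    then show "cmod (g x - p (unit_char x)) < e" using p(2)[of "unit_char x"] by simp
  qed
qed

lemma trig_poly_continuous: "trig_poly P \<Longrightarrow> continuous_on UNIV P"
  by (induction rule: trig_poly.induct) (intro continuous_intros | assumption)+

text \<open>Lusin-type approximation, clipped to the disc of radius \<open>B\<close> and multiplied by cutoffs.\<close>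

lemma trig_poly_L2_approx:
  fixes f :: "real \<Rightarrow> complex"
  assumes [measurable]: "f \<in> borel_measurable borel" and B: "\<And>x. cmod (f x) \<le> B" and "e > 0"
  obtains P where "trig_poly P" "(\<integral> x. (cmod (f x - P x))\<^sup>2 \<partial>cell) < e"
proof -
  have "B \<ge> 0" using B[of 0] norm_ge_zero order_trans by blast
  have "f \<in> borel_measurable lebesgue"
    by (rule measurable_completion) simp
  \<comment> \<open>The relation \<open>measurable_on\<close> supplies continuous functions that
    converge to f off a negligible set.\<close>
  then have "f measurable_on UNIV"
    by (subst measurable_on_iff_borel_measurable) (auto simp: lebesgue_on_UNIV_eq)
  then obtain N g where N: "negligible N" and g: "\<And>n. continuous_on UNIV (g n)"
    and lim: "\<And>x. x \<notin> N \<Longrightarrow> (\<lambda>n. g n x) \<longlonglongrightarrow> f x"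
    unfolding measurable_on_def by auto
  \<comment> \<open>For n > 0 this is 0 where |x| >= 1/2 - 1/n and 1 where |x| <= 1/2 - 2/n, so it
    tends to 1 at every interior point of the cell.\<close>
  define \<phi> where "\<phi> = (\<lambda>(n::nat) x. max 0 (min 1 (real n * (1/2 - \<bar>x\<bar>) - 1)))"
  \<comment> \<open>The projection onto this disc is continuous and fixes the values of f; it
    provides the constant bound for dominated convergence.\<close>
  define C where "C = cball (0::complex) B"
  define h where "h = (\<lambda>n x. \<phi> n x *\<^sub>R closest_point C (g n x))"
  have C: "closed C" "convex C" "C \<noteq> {}" using \<open>B \<ge> 0\<close> by (auto simp: C_def)
  have \<phi>: "0 \<le> \<phi> n x" "\<phi> n x \<le> 1" for n x by (auto simp: \<phi>_def)
  have h_cont: "continuous_on UNIV (h n)" for n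
    unfolding h_def \<phi>_def
    by (intro continuous_intros continuous_on_compose2[OF continuous_on_closest_point[OF C(2,1,3)] g]) auto
  have h_meas [measurable]: "h n \<in> borel_measurable borel" for n
    using h_cont by (rule borel_measurable_continuous_onI)
  have h_bound: "cmod (h n x) \<le> B" for n x
  proof -
    have "closest_point C (g n x) \<in> C" by (rule closest_point_in_set[OF C(1,3)])
    then have "cmod (closest_point C (g n x)) \<le> B" by (simp add: C_def)
    then show ?thesis
      using mult_mono[OF \<phi>(2)[of n x], of "cmod (closest_point C (g n x))" B] \<phi>[of n x]
      by (simp add: h_def)
  qed
  have h_lim: "(\<lambda>n. h n x) \<longlonglongrightarrow> f x" if "x \<notin> N" "x \<in> {-1/2<..<1/2}" for x
  proof -
    have "(\<lambda>n. closest_point C (g n x)) \<longlonglongrightarrow> closest_point C (f x)"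
      using continuous_on_closest_point[OF C(2,1,3), of UNIV] lim[OF that(1)]
      by (auto simp: continuous_on_eq_continuous_at intro: isCont_tendsto_compose)
    also have "closest_point C (f x) = f x"
      using B by (intro closest_point_self) (simp add: C_def)
    finally have 1: "(\<lambda>n. closest_point C (g n x)) \<longlonglongrightarrow> f x" .
    have "1/2 - \<bar>x\<bar> > 0" using that by auto
    then have "filterlim (\<lambda>n. real n * (1/2 - \<bar>x\<bar>) - 1) at_top sequentially"
      by real_asymp
    then have "\<forall>\<^sub>F n in sequentially. real n * (1/2 - \<bar>x\<bar>) - 1 \<ge> 1"
      unfolding filterlim_at_top by blast
    then have "\<forall>\<^sub>F n in sequentially. \<phi> n x = 1"
      by eventually_elim (simp add: \<phi>_def)
    then have "(\<lambda>n. \<phi> n x) \<longlonglongrightarrow> 1" by (rule tendsto_eventually)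
    from tendsto_scaleR[OF this 1] show ?thesis by (simp add: h_def)
  qed
  have AE_lim: "AE x in cell. (\<lambda>n. h n x) \<longlonglongrightarrow> f x"
  proof -
    have "N \<in> null_sets lebesgue" using N by (simp add: negligible_iff_null_sets)
    then have "AE x in lebesgue. x \<notin> N" by (rule AE_not_in)
    then have "AE x in lborel. x \<notin> N" by (simp add: AE_completion_iff)
    from AE_cellI[OF this] AE_cell show ?thesis
      by eventually_elim (rule h_lim)
  qed
  have "(\<lambda>n. \<integral> x. (cmod (f x - h n x))\<^sup>2 \<partial>cell) \<longlonglongrightarrow> (\<integral> x. 0 \<partial>cell)"
  proof (rule integral_dominated_convergence[where w = "\<lambda>_. (2 * B)\<^sup>2"])
    show "AE x in cell. (\<lambda>n. (cmod (f x - h n x))\<^sup>2) \<longlonglongrightarrow> 0"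
      using AE_lim
    proof eventually_elim
      case (elim x)
      have "(\<lambda>n. (cmod (f x - h n x))\<^sup>2) \<longlonglongrightarrow> (cmod (f x - f x))\<^sup>2"
        by (intro tendsto_intros elim)
      then show ?case by simp
    qed
    show "AE x in cell. norm ((cmod (f x - h n x))\<^sup>2) \<le> (2 * B)\<^sup>2" for n
    proof (rule AE_I2)
      fix x
      have "cmod (f x - h n x) \<le> 2 * B"
        using norm_triangle_ineq4[of "f x" "h n x"] B[of x] h_bound[of n x] by linarith
      then have "(cmod (f x - h n x))\<^sup>2 \<le> (2 * B)\<^sup>2" by (rule power_mono) simp
      then show "norm ((cmod (f x - h n x))\<^sup>2) \<le> (2 * B)\<^sup>2"
        unfolding real_norm_def abs_of_nonneg[OF zero_le_power2] .
    qed
  qed auto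
  \<comment> \<open>The square of a sum is at most twice the sum of the squares, and
    \<open>cell\<close> has mass 1. So e/4 for this error and e/4 for the square of the uniform one
    together stay below e.\<close>
  then have "\<forall>\<^sub>F n in sequentially. (\<integral> x. (cmod (f x - h n x))\<^sup>2 \<partial>cell) < e / 4"
    using \<open>e > 0\<close> by (intro order_tendstoD(2)) auto
  then have "\<forall>\<^sub>F n in sequentially. n > 0 \<and> (\<integral> x. (cmod (f x - h n x))\<^sup>2 \<partial>cell) < e / 4"
    using eventually_gt_at_top[of 0] by eventually_elim simp
  then obtain n where n: "n > 0" "(\<integral> x. (cmod (f x - h n x))\<^sup>2 \<partial>cell) < e / 4"
    unfolding eventually_sequentially by blast
  have h_supp: "h n x = 0" if "\<bar>x\<bar> \<ge> 1/2 - 1 / n" for x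
  proof -
    have "real n * (1/2 - \<bar>x\<bar>) \<le> real n * (1 / n)"
      using that by (intro mult_left_mono) auto
    then show ?thesis using n(1) by (simp add: h_def \<phi>_def)
  qed
  have "1 / real n > 0" "sqrt (e / 4) > 0" using n(1) \<open>e > 0\<close> by auto
  from trig_poly_uniform_approx[OF h_cont[of n] this(1) h_supp this(2)]
  obtain P where P: "trig_poly P" "\<And>x. x \<in> {-1/2<..<1/2} \<Longrightarrow> cmod (h n x - P x) < sqrt (e / 4)"
    by blast
  have [measurable]: "P \<in> borel_measurable borel"
    using trig_poly_continuous[OF P(1)] by (rule borel_measurable_continuous_onI)
  have int: "integrable cell (\<lambda>x. 2 * (cmod (f x - h n x))\<^sup>2 + 2 * (e / 4))"
  proof (rule integrable_cell_bounded)
    fix x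
    have "cmod (f x - h n x) \<le> 2 * B"
      using norm_triangle_ineq4[of "f x" "h n x"] B[of x] h_bound[of n x] by linarith
    then have "(cmod (f x - h n x))\<^sup>2 \<le> (2 * B)\<^sup>2" by (rule power_mono) simp
    then show "norm (2 * (cmod (f x - h n x))\<^sup>2 + 2 * (e / 4)) \<le> 2 * (2 * B)\<^sup>2 + 2 * (e / 4)"
      using \<open>e > 0\<close> by simp
  qed simp
  have "(\<integral> x. (cmod (f x - P x))\<^sup>2 \<partial>cell) \<le> (\<integral> x. 2 * (cmod (f x - h n x))\<^sup>2 + 2 * (e / 4) \<partial>cell)"
  proof (rule integral_mono_AE')
    show "AE x in cell. (cmod (f x - P x))\<^sup>2 \<le> 2 * (cmod (f x - h n x))\<^sup>2 + 2 * (e / 4)"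
      using AE_cell
    proof eventually_elim
      case (elim x)
      have "cmod (f x - P x) \<le> cmod (f x - h n x) + cmod (h n x - P x)"
        using norm_triangle_ineq[of "f x - h n x" "h n x - P x"] by simp
      then have "(cmod (f x - P x))\<^sup>2 \<le> (cmod (f x - h n x) + cmod (h n x - P x))\<^sup>2"
        by (rule power_mono) simp
      also have "\<dots> \<le> 2 * (cmod (f x - h n x))\<^sup>2 + 2 * (cmod (h n x - P x))\<^sup>2"
        using zero_le_power2[of "cmod (f x - h n x) - cmod (h n x - P x)"]
        by (simp add: power2_eq_square algebra_simps)
      also have "(cmod (h n x - P x))\<^sup>2 \<le> (sqrt (e / 4))\<^sup>2"
        using P(2)[OF elim] by (intro power_mono) auto
      finally show ?case using \<open>e > 0\<close> by simp
    qed
  qed (use int \<open>e > 0\<close> in \<open>auto intro!: AE_I2 add_nonneg_nonneg\<close>)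
  also have "\<dots> = 2 * (\<integral> x. (cmod (f x - h n x))\<^sup>2 \<partial>cell) + 2 * (e / 4)"
  proof -
    have "integrable cell (\<lambda>x. 2 * (cmod (f x - h n x))\<^sup>2)"
      using Bochner_Integration.integrable_diff[OF int, of "\<lambda>_. 2 * (e / 4)"] by simp
    then show ?thesis by (subst Bochner_Integration.integral_add) auto
  qed
  also have "\<dots> < e" using n(2) by simp
  finally show ?thesis using P(1) that by blast
qed

text \<open>The bridge between unordered sums and \<open>nn_integral\<close>: lattice sums are
  computed with counting measure, where Tonelli's theorem exchanges summations and
  integrations.\<close>

lemma has_sum_iff_nn_integral_count_space:
  fixes f :: "'b \<Rightarrow> real"
  assumes nonneg: "\<And>x. x \<in> A \<Longrightarrow> f x \<ge> 0" and "s \<ge> 0"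
  shows "(f has_sum s) A \<longleftrightarrow> (\<integral>\<^sup>+ x. ennreal (f x) \<partial>count_space A) = ennreal s"
proof -
  have integrable_iff: "f summable_on A \<longleftrightarrow> integrable (count_space A) f"
    using summable_on_iff_abs_summable_on_real[of f A] abs_summable_equivalent[of f A]
    by (simp add: abs_summable_on_def)
  have *: "(\<integral>\<^sup>+ x. ennreal (f x) \<partial>count_space A) = ennreal (infsum f A)" if "f summable_on A"
  proof -
    have int: "integrable (count_space A) f" using that integrable_iff by simp
    have "(\<integral>\<^sup>+ x. ennreal (f x) \<partial>count_space A) = ennreal (integral\<^sup>L (count_space A) f)"
      using int nonneg by (intro nn_integral_eq_integral) (auto simp: AE_count_space)
    also have "integral\<^sup>L (count_space A) f = infsum f A"
      using int infsetsum_infsum[of f A] by (simp add: abs_summable_on_def infsetsum_def)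
    finally show ?thesis .
  qed
  show ?thesis
  proof
    assume "(f has_sum s) A"
    then show "(\<integral>\<^sup>+ x. ennreal (f x) \<partial>count_space A) = ennreal s"
      using * by (metis has_sum_imp_summable infsumI)
  next
    assume eq: "(\<integral>\<^sup>+ x. ennreal (f x) \<partial>count_space A) = ennreal s"
    then have "integrable (count_space A) f"
      using nonneg by (intro integrableI_nonneg) (auto simp: AE_count_space)
    then have sum: "f summable_on A" using integrable_iff by simp
    then have "infsum f A = s"
      using * eq \<open>s \<ge> 0\<close> infsum_nonneg[OF nonneg, of A] by simp
    then show "(f has_sum s) A" using sum by (metis has_sum_infsum)
  qed
qed

text \<open>The sign in the exponent is opposite to the usual one; it matches the factor
  \<open>unit_char (of_int l * h)\<close> in the kernel values at lattice points. Hence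
  \<open>fourier_coeff f (- k)\<close> is the coefficient along
  \<open>unit_char (of_int k * x)\<close>.\<close>

definition fourier_coeff :: "(real \<Rightarrow> complex) \<Rightarrow> int \<Rightarrow> complex" where
  "fourier_coeff f k = (\<integral> x. f x * unit_char (of_int k * x) \<partial>cell)"

text \<open>Completing the square: on the right, c enters only through the last, nonnegative sum.
  Taking the Fourier coefficients for c gives Bessel's inequality; for arbitrary c the defect in
  Bessel's inequality is at most the approximation error.\<close>

lemma integral_cell_trig_diff_square:
  fixes f :: "real \<Rightarrow> complex"
  assumes [measurable]: "f \<in> borel_measurable borel" and B: "\<And>x. cmod (f x) \<le> B" and "finite K"
  shows "(\<integral> x. (cmod (f x - (\<Sum>k\<in>K. c k * unit_char (of_int k * x))))\<^sup>2 \<partial>cell) =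
    (\<integral> x. (cmod (f x))\<^sup>2 \<partial>cell) - (\<Sum>k\<in>K. (cmod (fourier_coeff f (- k)))\<^sup>2)
      + (\<Sum>k\<in>K. (cmod (c k - fourier_coeff f (- k)))\<^sup>2)"
proof -
  define P where "P = (\<lambda>x. \<Sum>k\<in>K. c k * unit_char (of_int k * x))"
  have B0: "B \<ge> 0" using B[of 0] norm_ge_zero order_trans by blast
  have Pm [measurable]: "P \<in> borel_measurable borel" unfolding P_def by measurable
  have Pb: "cmod (P x) \<le> (\<Sum>k\<in>K. cmod (c k))" for x
    unfolding P_def by (rule order_trans[OF norm_sum]) (simp add: norm_mult)
  have i1: "integrable cell (\<lambda>x. f x * cnj (f x))"
    by (rule integrable_cell_bounded[where B = "B * B"]) (auto simp: norm_mult intro!: mult_mono B B0)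
  have i2: "integrable cell (\<lambda>x. f x * cnj (P x))"
    by (rule integrable_cell_bounded[where B = "B * (\<Sum>k\<in>K. cmod (c k))"])
      (auto simp: norm_mult intro!: mult_mono B Pb B0)
  have i3: "integrable cell (\<lambda>x. P x * cnj (f x))"
    by (rule integrable_cell_bounded[where B = "(\<Sum>k\<in>K. cmod (c k)) * B"])
      (auto simp: norm_mult intro!: mult_mono B Pb B0 sum_nonneg)
  have i4: "integrable cell (\<lambda>x. P x * cnj (P x))"
    by (rule integrable_cell_bounded[where B = "(\<Sum>k\<in>K. cmod (c k)) * (\<Sum>k\<in>K. cmod (c k))"])
      (auto simp: norm_mult intro!: mult_mono Pb sum_nonneg)
  have i5: "integrable cell (\<lambda>x. f x * unit_char (of_int k * x))" for k
    by (rule integrable_cell_bounded[where B = B]) (auto simp: norm_mult B)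
  have i6: "integrable cell (\<lambda>x. unit_char (of_int j * x) * cnj (unit_char (of_int k * x)))" for j k
    by (rule integrable_cell_bounded[where B = 1]) (auto simp: norm_mult)
  have fP: "(\<integral> x. f x * cnj (P x) \<partial>cell) = (\<Sum>k\<in>K. cnj (c k) * fourier_coeff f (- k))"
  proof -
    have "(\<lambda>x. f x * cnj (P x)) = (\<lambda>x. \<Sum>k\<in>K. cnj (c k) * (f x * unit_char (of_int (- k) * x)))"
      by (simp add: P_def fun_eq_iff sum_distrib_left unit_char_minus mult_ac)
    then show ?thesis
      unfolding fourier_coeff_def
      by (simp only:) (subst Bochner_Integration.integral_sum, auto intro!: integrable_mult_right i5 simp del: of_int_minus)
  qed
  have Pf: "(\<integral> x. P x * cnj (f x) \<partial>cell) = cnj (\<Sum>k\<in>K. cnj (c k) * fourier_coeff f (- k))"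
    unfolding fP[symmetric] using integral_bounded_linear[OF bounded_linear_cnj i2]
    by (simp add: mult.commute)
  have PP: "(\<integral> x. P x * cnj (P x) \<partial>cell) = (\<Sum>k\<in>K. c k * cnj (c k))"
  proof -
    have "(\<lambda>x. P x * cnj (P x)) =
      (\<lambda>x. \<Sum>j\<in>K. \<Sum>k\<in>K. (c j * cnj (c k)) * (unit_char (of_int j * x) * cnj (unit_char (of_int k * x))))"
      by (simp add: P_def fun_eq_iff sum_product mult_ac)
    then have "(\<integral> x. P x * cnj (P x) \<partial>cell) = (\<Sum>j\<in>K. \<Sum>k\<in>K. (c j * cnj (c k)) * (if j = k then 1 else 0))"
      by (simp only:) (subst Bochner_Integration.integral_sum | subst integral_mult_right_zero |
          intro sum.cong refl Bochner_Integration.integrable_sum integrable_mult_right i6 |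
          simp only: integral_cell_unit_char_orthonormal)+
    also have "\<dots> = (\<Sum>k\<in>K. c k * cnj (c k))"
      using \<open>finite K\<close> by (simp add: if_distrib sum.delta cong: if_cong)
    finally show ?thesis .
  qed
  have "complex_of_real (\<integral> x. (cmod (f x - P x))\<^sup>2 \<partial>cell) = (\<integral> x. complex_of_real ((cmod (f x - P x))\<^sup>2) \<partial>cell)"
    by (rule integral_complex_of_real[symmetric])
  also have "\<dots> = (\<integral> x. f x * cnj (f x) - f x * cnj (P x) - P x * cnj (f x) + P x * cnj (P x) \<partial>cell)"
    by (rule Bochner_Integration.integral_cong) (simp_all add: complex_norm_square algebra_simps del: of_real_power)
  also have "\<dots> = (\<integral> x. f x * cnj (f x) \<partial>cell) - (\<integral> x. f x * cnj (P x) \<partial>cell)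
      - (\<integral> x. P x * cnj (f x) \<partial>cell) + (\<integral> x. P x * cnj (P x) \<partial>cell)"
    by (simp add: i1 i2 i3 i4)
  also have "(\<integral> x. f x * cnj (f x) \<partial>cell) = complex_of_real (\<integral> x. (cmod (f x))\<^sup>2 \<partial>cell)"
    unfolding integral_complex_of_real[symmetric]
    by (simp add: complex_norm_square del: of_real_power)
  also have "complex_of_real (\<integral> x. (cmod (f x))\<^sup>2 \<partial>cell) - (\<integral> x. f x * cnj (P x) \<partial>cell)
      - (\<integral> x. P x * cnj (f x) \<partial>cell) + (\<integral> x. P x * cnj (P x) \<partial>cell)
    = complex_of_real ((\<integral> x. (cmod (f x))\<^sup>2 \<partial>cell) - (\<Sum>k\<in>K. (cmod (fourier_coeff f (- k)))\<^sup>2)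
      + (\<Sum>k\<in>K. (cmod (c k - fourier_coeff f (- k)))\<^sup>2))"
    unfolding fP Pf PP
    by (simp add: complex_norm_square algebra_simps sum.distrib sum_subtractf del: of_real_power)
  finally show ?thesis unfolding P_def of_real_eq_iff .
qed

lemma parseval:
  fixes f :: "real \<Rightarrow> complex"
  assumes [measurable]: "f \<in> borel_measurable borel" and B: "\<And>x. cmod (f x) \<le> B"
  shows "(\<integral>\<^sup>+ k. ennreal ((cmod (fourier_coeff f k))\<^sup>2) \<partial>count_space UNIV) =
    (\<integral>\<^sup>+ x. ennreal ((cmod (f x))\<^sup>2) \<partial>cell)"
proof -
  let ?a = "\<lambda>k. (cmod (fourier_coeff f (- k)))\<^sup>2"
  define I where "I = (\<integral> x. (cmod (f x))\<^sup>2 \<partial>cell)"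
  have "I \<ge> 0" unfolding I_def by simp
  have bessel: "sum ?a K \<le> I" if "finite K" for K
  proof -
    have "0 \<le> (\<integral> x. (cmod (f x - (\<Sum>k\<in>K. fourier_coeff f (- k) * unit_char (of_int k * x))))\<^sup>2 \<partial>cell)"
      by simp
    also have "\<dots> = I - sum ?a K"
      by (subst integral_cell_trig_diff_square[OF assms that]) (simp add: I_def)
    finally show ?thesis by simp
  qed
  have approx: "\<exists>K. finite K \<and> I - e < sum ?a K" if e: "e > 0" for e
  proof -
    obtain P where P: "trig_poly P" "(\<integral> x. (cmod (f x - P x))\<^sup>2 \<partial>cell) < e"
      using trig_poly_L2_approx[OF assms(1) B e] by blast
    from P(1) obtain K c where K: "finite K" "P = (\<lambda>x. \<Sum>k\<in>K. c k * unit_char (of_int k * x))"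
      by (rule trig_poly_obtain_coeffs)
    have "I - sum ?a K \<le> I - sum ?a K + (\<Sum>k\<in>K. (cmod (c k - fourier_coeff f (- k)))\<^sup>2)"
      by (simp add: sum_nonneg)
    also have "\<dots> < e"
      using P(2) unfolding K(2) by (subst (asm) integral_cell_trig_diff_square[OF assms K(1)]) (simp add: I_def)
    finally show ?thesis using K(1) by (intro exI[of _ K]) auto
  qed
  \<comment> \<open>Partial sums of nonnegative terms grow with the index set, so one good finite
    set controls all larger ones.\<close>
  have hs: "(?a has_sum I) UNIV"
    unfolding has_sum_def
  proof (rule order_tendstoI)
    fix a assume "a < I"
    then obtain K where K: "finite K" "I - (I - a) < sum ?a K" using approx[of "I - a"] by auto
    then show "\<forall>\<^sub>F L in finite_subsets_at_top UNIV. a < sum ?a L"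
      unfolding eventually_finite_subsets_at_top
    proof (intro exI[of _ K] conjI allI impI)
      fix L assume L: "finite L \<and> K \<subseteq> L \<and> L \<subseteq> UNIV"
      have "a < sum ?a K" using K by simp
      also have "\<dots> \<le> sum ?a L" using L by (intro sum_mono2) auto
      finally show "a < sum ?a L" .
    qed (use K in auto)
  next
    fix a assume "I < a"
    then show "\<forall>\<^sub>F L in finite_subsets_at_top UNIV. sum ?a L < a"
      by (intro eventually_finite_subsets_at_top_weakI) (use bessel le_less_trans in blast)
  qed
  \<comment> \<open>Reflecting k undoes the sign convention of the coefficients.\<close>
  have "(\<integral>\<^sup>+ k. ennreal ((cmod (fourier_coeff f k))\<^sup>2) \<partial>count_space UNIV)
      = (\<integral>\<^sup>+ k. ennreal (?a k) \<partial>count_space UNIV)"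
    by (rule nn_integral_bij_count_space[symmetric, of uminus UNIV UNIV
          "\<lambda>k. ennreal ((cmod (fourier_coeff f k))\<^sup>2)"]) (auto intro: bij_uminus)
  also have "\<dots> = ennreal I"
    using hs \<open>I \<ge> 0\<close> by (simp add: has_sum_iff_nn_integral_count_space)
  also have "\<dots> = (\<integral>\<^sup>+ x. ennreal ((cmod (f x))\<^sup>2) \<partial>cell)"
    unfolding I_def
  proof (rule nn_integral_eq_integral[symmetric])
    show "integrable cell (\<lambda>x. (cmod (f x))\<^sup>2)"
      by (rule integrable_cell_bounded[where B = "B\<^sup>2"]) (auto intro: power_mono B)
  qed simp
  finally show ?thesis .
qed

section \<open>The kernel\<close>

abbreviation chi :: "real \<Rightarrow> real" where
  "chi \<equiv> indicator {-1/2..<1/2}"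

section \<open>Tiling the line, and Parseval's identity on short intervals\<close>

lemma nn_integral_tile:
  assumes [measurable]: "g \<in> borel_measurable borel"
  shows "(\<integral>\<^sup>+ m. \<integral>\<^sup>+ u. g (u + of_int m) \<partial>cell \<partial>count_space UNIV) = (\<integral>\<^sup>+ u. g u \<partial>lborel)"
proof -
  let ?D = "{-1/2..<1/2::real}"
  have "(\<integral>\<^sup>+ u. g (u + of_int m) \<partial>cell) = (\<integral>\<^sup>+ v. indicator ?D (v - of_int m) * g v \<partial>lborel)" for m
    by (subst nn_integral_cell, simp)
      (subst nn_integral_real_affine[where c = 1 and t = "- of_int m"], auto simp: add.commute)
  then have "(\<integral>\<^sup>+ m. \<integral>\<^sup>+ u. g (u + of_int m) \<partial>cell \<partial>count_space UNIV) =
      (\<integral>\<^sup>+ v. \<integral>\<^sup>+ m. indicator ?D (v - of_int m) * g v \<partial>count_space UNIV \<partial>lborel)"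
    by (simp add: nn_integral_count_space_nn_integral)
  also have "\<dots> = (\<integral>\<^sup>+ v. g v \<partial>lborel)"
  proof (rule nn_integral_cong)
    fix v :: real
    \<comment> \<open>Exactly one integer translate of the half-open interval contains v.\<close>
    have "v - of_int m \<in> ?D \<longleftrightarrow> m = \<lfloor>v + 1/2\<rfloor>" for m
      by (subst eq_commute, subst floor_eq_iff) auto
    then have "(\<integral>\<^sup>+ m. indicator ?D (v - of_int m) * g v \<partial>count_space UNIV) =
        (\<integral>\<^sup>+ m. g v * indicator {\<lfloor>v + 1/2\<rfloor>} m \<partial>count_space UNIV)"
      by (intro nn_integral_cong) (simp add: indicator_def)
    also have "\<dots> = g v"
      by (subst nn_integral_cmult_indicator) auto
    finally show "(\<integral>\<^sup>+ m. indicator ?D (v - of_int m) * g v \<partial>count_space UNIV) = g v" .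
  qed
  finally show ?thesis .
qed

text \<open>The density |h| of the Plancherel measure of the Heisenberg group, restricted to a
  frequency band of length one.\<close>

definition wt :: "real \<Rightarrow> real" where
  "wt h = chi h * \<bar>h\<bar>"

lemma borel_measurable_wt [measurable]: "wt \<in> borel_measurable borel"
  unfolding wt_def by measurable

lemma wt_nonneg: "wt h \<ge> 0"
  by (simp add: wt_def)

lemma wt_le: "wt h \<le> 1"
  by (auto simp: wt_def indicator_def)

text \<open>The substitution v = - h u turns the integral over u, multiplied by |h|, into a Fourier
  coefficient of a function living on an interval of length |h|. Its squared norm acquires the
  Jacobian |h| only once, so the squared weight on the left becomes the plain weight on the right.
  Where \<open>wt h\<close> vanishes both sides are 0.\<close>

lemma parseval_scaled:
  fixes a :: "real \<Rightarrow> complex"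
  assumes [measurable]: "a \<in> borel_measurable borel" and B: "\<And>x. cmod (a x) \<le> B"
  shows "(\<integral>\<^sup>+ k. ennreal ((cmod (wt h * (\<integral> u. a u * unit_char (- (h * of_int k * u)) \<partial>cell)))\<^sup>2) \<partial>count_space UNIV)
    = ennreal (wt h) * (\<integral>\<^sup>+ u. ennreal ((cmod (a u))\<^sup>2) \<partial>cell)"
proof (cases "h \<in> {-1/2..<1/2} \<and> h \<noteq> 0")
  case True
  define f where "f = (\<lambda>v. chi (- (v / h)) *\<^sub>R a (- (v / h)))"
  have "B \<ge> 0" using B[of 0] norm_ge_zero order_trans by blast
  have h: "h \<noteq> 0" "- h \<noteq> 0" "\<bar>h\<bar> \<le> 1/2" "wt h = \<bar>h\<bar>" using True by (auto simp: wt_def)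
  have [measurable]: "f \<in> borel_measurable borel" unfolding f_def by measurable
  have fB: "cmod (f v) \<le> B" for v
    using B \<open>B \<ge> 0\<close> by (simp add: f_def indicator_def)
  \<comment> \<open>Both |h| and |u| are at most 1/2, so the rescaled interval stays within the cell
    and no mass is cut off.\<close>
  have inD: "- (h * u) \<in> {-1/2..<1/2}" if "u \<in> {-1/2..<1/2}" for u
  proof -
    have "\<bar>u\<bar> \<le> 1/2" using that by auto
    then have "\<bar>h * u\<bar> \<le> 1/2 * (1/2)" unfolding abs_mult using h(3) by (intro mult_mono) auto
    then show ?thesis by auto
  qed
  have coeff: "fourier_coeff f k = wt h * (\<integral> u. a u * unit_char (- (h * of_int k * u)) \<partial>cell)" for k
  proof -
    have "fourier_coeff f k = (\<integral> v. chi v *\<^sub>R (f v * unit_char (of_int k * v)) \<partial>lborel)"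
      unfolding fourier_coeff_def by (rule integral_cell) measurable
    also have "\<dots> = \<bar>- h\<bar> *\<^sub>R (\<integral> u. chi (0 + - h * u) *\<^sub>R (f (0 + - h * u) * unit_char (of_int k * (0 + - h * u))) \<partial>lborel)"
      by (rule lborel_integral_real_affine[OF h(2)])
    also have "(\<lambda>u. chi (0 + - h * u) *\<^sub>R (f (0 + - h * u) * unit_char (of_int k * (0 + - h * u)))) =
        (\<lambda>u. chi u *\<^sub>R (a u * unit_char (- (h * of_int k * u))))"
      using inD h(1) by (auto simp: fun_eq_iff f_def indicator_def mult_ac)
    also have "(\<integral> u. chi u *\<^sub>R (a u * unit_char (- (h * of_int k * u))) \<partial>lborel) =
        (\<integral> u. a u * unit_char (- (h * of_int k * u)) \<partial>cell)"
      by (rule integral_cell[symmetric]) measurable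
    finally show ?thesis by (simp add: h(4) scaleR_conv_of_real)
  qed
  have "(\<integral>\<^sup>+ x. ennreal ((cmod (f x))\<^sup>2) \<partial>cell) = (\<integral>\<^sup>+ v. indicator {-1/2..<1/2} v * ennreal ((cmod (f v))\<^sup>2) \<partial>lborel)"
    by (rule nn_integral_cell) measurable
  also have "\<dots> = ennreal \<bar>- h\<bar> * (\<integral>\<^sup>+ u. indicator {-1/2..<1/2} (0 + - h * u) * ennreal ((cmod (f (0 + - h * u)))\<^sup>2) \<partial>lborel)"
    by (rule nn_integral_real_affine[OF _ h(2)]) measurable
  also have "(\<lambda>u. indicator {-1/2..<1/2} (0 + - h * u) * ennreal ((cmod (f (0 + - h * u)))\<^sup>2)) =
      (\<lambda>u. indicator {-1/2..<1/2} u * ennreal ((cmod (a u))\<^sup>2))"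
    using inD h(1) by (auto simp: fun_eq_iff f_def indicator_def)
  also have "(\<integral>\<^sup>+ u. indicator {-1/2..<1/2} u * ennreal ((cmod (a u))\<^sup>2) \<partial>lborel) = (\<integral>\<^sup>+ u. ennreal ((cmod (a u))\<^sup>2) \<partial>cell)"
    by (rule nn_integral_cell[symmetric]) measurable
  finally show ?thesis
    using parseval[of f B] fB unfolding coeff by (simp add: h(4))
next
  case False
  then have "wt h = 0" by (auto simp: wt_def)
  then show ?thesis by simp
qed

text \<open>For fixed k the sum over l is Parseval's identity in h, applied to a bounded function of
  h. After the sum over k and the integral over h are exchanged, \<open>parseval_scaled\<close>
  evaluates the sum for each h.\<close>

lemma parseval_shear:
  fixes a :: "real \<Rightarrow> real \<Rightarrow> complex"
  assumes a [measurable]: "case_prod a \<in> borel_measurable (borel \<Otimes>\<^sub>M borel)"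
    and B: "\<And>h u. cmod (a h u) \<le> B"
  shows "(\<integral>\<^sup>+ k. \<integral>\<^sup>+ l. ennreal ((cmod (\<integral> h. (wt h * (\<integral> u. a h u * unit_char (- (h * of_int k * u)) \<partial>cell)) *
      unit_char (of_int l * h) \<partial>cell))\<^sup>2) \<partial>count_space UNIV \<partial>count_space UNIV)
    = (\<integral>\<^sup>+ h. ennreal (wt h) * (\<integral>\<^sup>+ u. ennreal ((cmod (a h u))\<^sup>2) \<partial>cell) \<partial>cell)"
proof -
  define g where "g = (\<lambda>k h. wt h * (\<integral> u. a h u * unit_char (- (h * of_int k * u)) \<partial>cell))"
  have B0: "B \<ge> 0" using B[of 0] norm_ge_zero order_trans by blast
  have [measurable]: "g k \<in> borel_measurable borel" for k
    unfolding g_def by measurable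
  have am [measurable]: "a h \<in> borel_measurable borel" for h
    using measurable_compose[OF measurable_Pair1' a, of h] by simp
  have gB: "cmod (g k h) \<le> 1 * B" for k h
  proof -
    have "cmod (\<integral> u. a h u * unit_char (- (h * of_int k * u)) \<partial>cell) \<le> (\<integral> u. B \<partial>cell)"
      by (rule order_trans[OF integral_norm_bound Bochner_Integration.integral_mono])
        (auto simp: norm_mult B B0 intro!: integrable_cell_bounded[where B = B])
    then show ?thesis
      unfolding g_def norm_mult using wt_le[of h] wt_nonneg[of h] by (intro mult_mono) auto
  qed
  have "(\<integral>\<^sup>+ k. \<integral>\<^sup>+ l. ennreal ((cmod (\<integral> h. g k h * unit_char (of_int l * h) \<partial>cell))\<^sup>2) \<partial>count_space UNIV \<partial>count_space UNIV)
      = (\<integral>\<^sup>+ k. \<integral>\<^sup>+ h. ennreal ((cmod (g k h))\<^sup>2) \<partial>cell \<partial>count_space UNIV)"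
  proof (rule nn_integral_cong)
    fix k
    show "(\<integral>\<^sup>+ l. ennreal ((cmod (\<integral> h. g k h * unit_char (of_int l * h) \<partial>cell))\<^sup>2) \<partial>count_space UNIV)
        = (\<integral>\<^sup>+ h. ennreal ((cmod (g k h))\<^sup>2) \<partial>cell)"
      using parseval[of "g k" "1 * B"] gB unfolding fourier_coeff_def by simp
  qed
  also have "\<dots> = (\<integral>\<^sup>+ h. \<integral>\<^sup>+ k. ennreal ((cmod (g k h))\<^sup>2) \<partial>count_space UNIV \<partial>cell)"
    by (rule nn_integral_count_space_nn_integral[symmetric]) auto
  also have "\<dots> = (\<integral>\<^sup>+ h. ennreal (wt h) * (\<integral>\<^sup>+ u. ennreal ((cmod (a h u))\<^sup>2) \<partial>cell) \<partial>cell)"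
    unfolding g_def by (intro nn_integral_cong parseval_scaled[where B = B]) (auto simp: B)
  finally show ?thesis unfolding g_def .
qed

section \<open>The Fourier transform \<open>kap\<close> of the weight, and the closed form of the
  kernel\<close>

definition kap :: "real \<Rightarrow> real" where
  "kap s = (2 * nsinc s - (nsinc (s / 2))\<^sup>2) / 4"

text \<open>Away from 0 this is the square of sin(pi s / 2) divided by pi^2 s; the form with
  \<open>nsinc\<close> covers 0 as well. Its values at the ends of an interval produce the two
  squared sinc terms of \<open>heis_sinc\<close>.\<close>

definition kap_primitive :: "real \<Rightarrow> real" where
  "kap_primitive s = s / 4 * (nsinc (s / 2))\<^sup>2"

lemma continuous_nsinc: "isCont nsinc x"
proof (cases "x = 0")
  case False
  have "\<forall>\<^sub>F y in nhds x. y \<noteq> 0"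
    using False by (intro t1_space_nhds) auto
  then have "\<forall>\<^sub>F y in nhds x. sin (pi * y) / (pi * y) = nsinc y"
    by eventually_elim (simp add: nsinc_def)
  moreover have "isCont (\<lambda>y. sin (pi * y) / (pi * y)) x"
    using False by (intro continuous_intros) auto
  ultimately show ?thesis by (simp add: isCont_cong)
next
  case True
  have "((\<lambda>y. sin (pi * y) / (pi * y)) \<longlongrightarrow> 1) (at 0)" by real_asymp
  then have "(nsinc \<longlongrightarrow> 1) (at 0)"
    by (rule Lim_transform_eventually) (auto simp: eventually_at_filter nsinc_def)
  then show ?thesis using True by (simp add: isCont_def nsinc_def)
qed

lemma continuous_on_nsinc [continuous_intros]:
  "continuous_on A f \<Longrightarrow> continuous_on A (\<lambda>x. nsinc (f x))"
  using continuous_on_compose2[of UNIV nsinc A f] continuous_nsinc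
  by (auto simp: continuous_on_eq_continuous_at)

lemma continuous_on_kap [continuous_intros]:
  "continuous_on A f \<Longrightarrow> continuous_on A (\<lambda>x. kap (f x))"
  unfolding kap_def by (intro continuous_intros) auto

lemma borel_measurable_kap [measurable]: "kap \<in> borel_measurable borel"
  by (intro borel_measurable_continuous_onI continuous_intros)

text \<open>At 0 the difference quotient is a quarter of a squared \<open>nsinc\<close>, with limit
  1/4; elsewhere the quotient with sine in the numerator is differentiated and compared by the
  double-angle formula.\<close>

lemma kap_primitive_has_derivative: "(kap_primitive has_real_derivative kap s) (at s)"
proof (cases "s = 0")
  case True
  have "isCont (\<lambda>y. (nsinc (y / 2))\<^sup>2 / 4) 0"
    by (intro continuous_intros isCont_o2[OF _ continuous_nsinc]) auto
  then have "((\<lambda>y. (nsinc (y / 2))\<^sup>2 / 4) \<longlongrightarrow> kap 0) (at 0)"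
    by (simp add: isCont_def kap_def nsinc_def)
  then have "((\<lambda>y. (kap_primitive y - kap_primitive 0) / (y - 0)) \<longlongrightarrow> kap 0) (at 0)"
    by (rule Lim_transform_eventually) (auto simp: eventually_at_filter kap_primitive_def)
  then show ?thesis using True by (simp add: has_field_derivative_iff)
next
  case False
  have "\<forall>\<^sub>F y in nhds s. y \<noteq> 0"
    using False by (intro t1_space_nhds) auto
  then have "\<forall>\<^sub>F y in nhds s. (sin (pi * y / 2))\<^sup>2 / (pi\<^sup>2 * y) = kap_primitive y"
    by eventually_elim (simp add: nsinc_def kap_primitive_def field_simps power2_eq_square)
  moreover have "((\<lambda>y. (sin (pi * y / 2))\<^sup>2 / (pi\<^sup>2 * y)) has_real_derivative kap s) (at s)"
  proof -
    have "sin (pi * s) = 2 * sin (pi * s / 2) * cos (pi * s / 2)"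
      using sin_double[of "pi * s / 2"] by simp
    then show ?thesis
      using False
      by (auto intro!: derivative_eq_intros simp: kap_def nsinc_def)
        (simp add: field_simps power2_eq_square)
  qed
  ultimately show ?thesis by (subst (asm) DERIV_cong_ev[OF refl _ refl])
qed

text \<open>The frequencies h and -h carry equal weight and conjugate exponentials, hence twice the
  cosine on half of the band.\<close>

lemma integral_half_cell:
  "has_bochner_integral lborel (\<lambda>h. (2 * h * cos (2 * pi * h * s)) * indicator {0..1/2} h) (kap s)"
proof (cases "s = 0")
  case True
  have "has_bochner_integral lborel (\<lambda>h. (2 * h * cos (2 * pi * h * s)) * indicator {0..1/2} h) ((1/2)\<^sup>2 - 0\<^sup>2)"
    by (rule has_bochner_integral_FTC_Icc_real[where F = "\<lambda>h. h\<^sup>2"])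
      (use True in \<open>auto intro!: derivative_eq_intros\<close>)
  then show ?thesis using True by (simp add: kap_def nsinc_def power2_eq_square)
next
  case False
  \<comment> \<open>An antiderivative, obtained by integration by parts.\<close>
  define F where "F = (\<lambda>h. h * sin (2 * pi * h * s) / (pi * s) + cos (2 * pi * h * s) / (2 * (pi * s)\<^sup>2))"
  have "has_bochner_integral lborel (\<lambda>h. (2 * h * cos (2 * pi * h * s)) * indicator {0..1/2} h) (F (1/2) - F 0)"
  proof (rule has_bochner_integral_FTC_Icc_real)
    fix h
    show "(F has_real_derivative 2 * h * cos (2 * pi * h * s)) (at h)"
      unfolding F_def using False
      by (auto intro!: derivative_eq_intros) (simp add: field_simps power2_eq_square power4_eq_xxxx)
  qed (auto intro!: continuous_intros)
  also have "F (1/2) - F 0 = kap s"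
  proof -
    have "cos (pi * s) = 1 - 2 * (sin (pi * s / 2))\<^sup>2"
      using cos_double_sin[of "pi * s / 2"] by simp
    then show ?thesis
      using False by (simp add: F_def kap_def nsinc_def) (simp add: field_simps power2_eq_square)
  qed
  finally show ?thesis .
qed

lemma kap_eq_integral: "(\<integral> h. of_real (wt h) * unit_char (h * s) \<partial>cell) = complex_of_real (kap s)"
proof -
  \<comment> \<open>The integral is split at 0: f is the part over h >= 0, and g is the part over h
    <= 0 after reflection. The closed intervals overlap at 0 and include 1/2, which is a null
    set.\<close>
  define f where "f = (\<lambda>h. indicator {0..1/2} h *\<^sub>R (of_real h * unit_char (h * s)))"
  have f: "integrable lborel f"
    unfolding f_def using borel_integrable_atLeastAtMost'[of 0 "1/2" "\<lambda>h. of_real h * unit_char (h * s)"]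
    by (simp add: set_integrable_def continuous_intros)
  define g where "g = (\<lambda>h. indicator {0..1/2} h *\<^sub>R (of_real h * unit_char (- (h * s))))"
  have g: "integrable lborel g"
    unfolding g_def using borel_integrable_atLeastAtMost'[of 0 "1/2" "\<lambda>h. of_real h * unit_char (- (h * s))"]
    by (simp add: set_integrable_def continuous_intros)
  have g': "integrable lborel (\<lambda>h. g (0 + - 1 * h))"
    by (rule lborel_integrable_real_affine[OF g]) simp
  have "(\<integral> h. of_real (wt h) * unit_char (h * s) \<partial>cell) = (\<integral> h. chi h *\<^sub>R (of_real (wt h) * unit_char (h * s)) \<partial>lborel)"
    by (rule integral_cell) measurable
  also have "\<dots> = (\<integral> h. f h + g (0 + - 1 * h) \<partial>lborel)"
  proof (rule integral_cong_AE)
    have "AE h in lborel. h \<noteq> (1/2::real) \<and> h \<noteq> 0"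
      using AE_lborel_singleton[of "1/2::real"] AE_lborel_singleton[of "0::real"] by eventually_elim simp
    then show "AE h in lborel. chi h *\<^sub>R (of_real (wt h) * unit_char (h * s)) = f h + g (0 + - 1 * h)"
      by eventually_elim (auto simp: f_def g_def wt_def indicator_def)
  qed (auto simp: f_def g_def)
  also have "\<dots> = (\<integral> h. f h \<partial>lborel) + (\<integral> h. g (0 + - 1 * h) \<partial>lborel)"
    by (rule Bochner_Integration.integral_add[OF f g'])
  also have "(\<integral> h. g (0 + - 1 * h) \<partial>lborel) = (\<integral> h. g h \<partial>lborel)"
    by (subst (2) lborel_integral_real_affine[where c = "-1" and t = 0]) auto
  also have "(\<integral> h. f h \<partial>lborel) + (\<integral> h. g h \<partial>lborel) = (\<integral> h. f h + g h \<partial>lborel)"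
    by (rule Bochner_Integration.integral_add[symmetric, OF f g])
  also have "\<dots> = (\<integral> h. complex_of_real ((2 * h * cos (2 * pi * h * s)) * indicator {0..1/2} h) \<partial>lborel)"
    by (rule Bochner_Integration.integral_cong)
      (auto simp: f_def g_def indicator_def unit_char_def complex_eq_iff mult_ac)
  also have "\<dots> = complex_of_real (kap s)"
    unfolding integral_complex_of_real has_bochner_integral_integral_eq[OF integral_half_cell[of s]] ..
  finally show ?thesis .
qed

text \<open>The Schroedinger representation with parameter h sends f to the function u \<mapsto>
  e^(2 pi i h \<open>phase z u\<close>) f(u - p), where p is the first coordinate of z.\<close>

fun phase :: "heis \<Rightarrow> real \<Rightarrow> real" where
  "phase (p, q, t) u = t + p * q / 2 - q * u"

lemma continuous_on_phase [continuous_intros]: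
  "continuous_on A f \<Longrightarrow> continuous_on A (\<lambda>x. phase z (f x))"
  by (cases z) (auto intro!: continuous_intros)

lemma borel_measurable_phase [measurable]: "phase x \<in> borel_measurable borel"
  by (intro borel_measurable_continuous_onI continuous_intros)

text \<open>The integral of matrix coefficients of \<open>chi\<close> with the integration over h
  already carried out, which leaves \<open>kap\<close>.\<close>

definition heis_ker :: "heis \<Rightarrow> real" where
  "heis_ker z = (\<integral> u. chi u * chi (u - fst z) * kap (phase z u) \<partial>lborel)"

text \<open>The unit interval and its translate by p overlap in an interval with centre p/2 and
  half-length w = (1 - |p|)/2. There the exponent is affine in u with slope -q and takes the values
  t + q w and t - q w at the ends, whence the difference of two squared sinc terms. For q = 0 the
  integrand is constant on the overlap.\<close>

lemma heis_sinc_eq_ker: "heis_sinc z = of_real (heis_ker z)"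
proof (cases z)
  case (fields p q t)
  show ?thesis
  proof (cases "\<bar>p\<bar> > 1")
    case True
    then have "(\<lambda>u. chi u * chi (u - fst z) * kap (phase z u)) = (\<lambda>u. 0)"
      by (auto simp: fun_eq_iff fields indicator_def)
    then show ?thesis using True by (simp add: fields heis_ker_def)
  next
    case False
    define w where "w = (1 - \<bar>p\<bar>) / 2"
    define F where "F = (\<lambda>u. if q = 0 then u * kap t else - kap_primitive (phase z u) / q)"
    have "w \<ge> 0" using False by (simp add: w_def)
    have "heis_ker z = (\<integral> u. kap (phase z u) * indicator {p/2 - w..p/2 + w} u \<partial>lborel)"
      unfolding heis_ker_def
    proof (rule integral_cong_AE)
      have "AE u in lborel. u \<noteq> (1/2::real) \<and> u \<noteq> 1/2 + p"
        using AE_lborel_singleton[of "1/2::real"] AE_lborel_singleton[of "1/2 + p"] by eventually_elim simp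
      then show "AE u in lborel. chi u * chi (u - fst z) * kap (phase z u) = kap (phase z u) * indicator {p/2 - w..p/2 + w} u"
        by eventually_elim (auto simp: fields indicator_def w_def abs_if field_simps split: if_splits)
    qed (auto simp: fields)
    also have "\<dots> = F (p/2 + w) - F (p/2 - w)"
    proof (rule integral_FTC_Icc_real)
      fix u
      show "(F has_real_derivative kap (phase z u)) (at u)"
      proof (cases "q = 0")
        case True
        then show ?thesis by (auto simp: F_def fields intro!: derivative_eq_intros)
      next
        case False
        have "((\<lambda>u. kap_primitive (phase z u)) has_real_derivative kap (phase z u) * (- q)) (at u)"
          by (rule DERIV_chain2[OF kap_primitive_has_derivative]) (auto simp: fields intro!: derivative_eq_intros)
        from DERIV_cdivide[OF this, of "- q"] show ?thesis using False by (simp add: F_def)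
      qed
      show "isCont (\<lambda>u. kap (phase z u)) u"
      proof -
        have "continuous_on UNIV (\<lambda>u. kap (phase z u))" by (intro continuous_intros)
        then show ?thesis by (simp add: continuous_on_eq_continuous_at)
      qed
    qed (use \<open>w \<ge> 0\<close> in auto)
    finally have *: "heis_ker z = F (p/2 + w) - F (p/2 - w)" .
    show ?thesis
    proof (cases "q = 0")
      case True
      then have k: "heis_ker z = (1 - \<bar>p\<bar>) / 4 * (2 * nsinc t - (nsinc (t / 2))\<^sup>2)"
        unfolding * by (simp add: F_def kap_def w_def field_simps)
      show ?thesis unfolding k using True False by (simp add: fields)
    next
      case q: False
      have "F (p/2 + w) - F (p/2 - w) = (kap_primitive (t + q * w) - kap_primitive (t - q * w)) / q"
      proof -
        have "phase z (p/2 + w) = t - q * w" "phase z (p/2 - w) = t + q * w"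
          by (simp_all add: fields algebra_simps)
        then show ?thesis using q by (simp add: F_def diff_divide_distrib)
      qed
      also have "\<dots> = 1/4 * ((t / q + w) * (nsinc (t / 2 + w / 2 * q))\<^sup>2 - (t / q - w) * (nsinc (t / 2 - w / 2 * q))\<^sup>2)"
      proof -
        have "(t + q * w) / 2 = t / 2 + w / 2 * q" "(t - q * w) / 2 = t / 2 - w / 2 * q" by (simp_all add: field_simps)
        then show ?thesis using q unfolding kap_primitive_def by (simp only:) (simp add: field_simps)
      qed
      finally have k: "heis_ker z = 1/4 * ((t / q + w) * (nsinc (t / 2 + w / 2 * q))\<^sup>2 -
          (t / q - w) * (nsinc (t / 2 - w / 2 * q))\<^sup>2)"
        unfolding * .
      show ?thesis unfolding k using False q by (simp add: fields w_def)
    qed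
  qed
qed

lemma kap_eq_integral_cos:
  "(\<integral> h. wt h * cos (2 * pi * (h * s)) \<partial>cell) = kap s"
proof -
  have "integrable cell (\<lambda>h. of_real (wt h) * unit_char (h * s))"
    by (rule integrable_cell_bounded[where B = 1]) (auto simp: norm_mult wt_le wt_nonneg)
  from integral_Re[OF this] show ?thesis
    unfolding kap_eq_integral by (simp add: unit_char_def)
qed

text \<open>The constant is the total mass of \<open>wt\<close>, attained at s = 0.\<close>

lemma abs_kap_le: "\<bar>kap s\<bar> \<le> 1/4"
proof -
  have "norm (\<integral> h. wt h * cos (2 * pi * (h * s)) \<partial>cell) \<le> (\<integral> h. wt h \<partial>cell)"
  proof (rule order_trans[OF integral_norm_bound Bochner_Integration.integral_mono])
    have *: "norm (wt h * cos (2 * pi * (h * s))) \<le> wt h" for h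
      using mult_left_mono[OF abs_cos_le_one wt_nonneg, of h "2 * pi * (h * s)"]
      by (simp add: abs_mult wt_nonneg)
    then show "norm (wt h * cos (2 * pi * (h * s))) \<le> wt h" for h .
    show "integrable cell wt"
      by (rule integrable_cell_bounded[where B = 1]) (auto simp: wt_le wt_nonneg)
    show "integrable cell (\<lambda>h. norm (wt h * cos (2 * pi * (h * s))))"
      by (rule integrable_cell_bounded[where B = 1]) (use * wt_le in \<open>auto intro: order_trans\<close>)
  qed
  moreover have "(\<integral> h. wt h \<partial>cell) = 1/4"
    using kap_eq_integral_cos[of 0] by (simp add: kap_def nsinc_def)
  ultimately show ?thesis unfolding kap_eq_integral_cos by simp
qed

lemma integrable_chi_mult:
  assumes "f \<in> borel_measurable borel" "\<And>u. \<bar>f u\<bar> \<le> B"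
  shows "integrable lborel (\<lambda>u. chi (u - p) * f u :: real)"
proof -
  have "integrable cell (\<lambda>u. f (u + p))"
    by (rule integrable_cell_bounded[where B = B]) (use assms in auto)
  then have "integrable lborel (\<lambda>u. chi u * f (u + p))"
    unfolding cell_def by (subst (asm) integrable_density) (use assms(1) in auto)
  from lborel_integrable_real_affine[OF this, of 1 "- p"] show ?thesis
    by (simp add: algebra_simps)
qed

text \<open>Rests on the cocycle property of the exponent: after u is moved by the first coordinate
  of x, the exponent of the product is the difference of the exponents of z and x.\<close>

lemma heis_ker_left_mult:
  "heis_ker (heis_mult (heis_inv x) z) =
    (\<integral> u. chi (u - fst x) * chi (u - fst z) * kap (phase z u - phase x u) \<partial>lborel)"
proof (cases x; cases z)
  fix p q t m k s assume x: "x = (p, q, t)" and z: "z = (m, k, s)"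
  have *: "phase (heis_mult (heis_inv x) z) (- p + 1 * u) = phase z u - phase x u" for u
    by (simp add: x z field_simps)
  show ?thesis
    unfolding heis_ker_def
    by (subst lborel_integral_real_affine[where c = 1 and t = "- p"], simp, subst *)
      (simp add: x z algebra_simps)
qed

text \<open>The translate of \<^const>\<open>heis_sinc\<close> by \<open>x\<close> corresponds to \<open>wave x\<close> under an isometry into
  \<open>L\<^sup>2(wt(h) dh du)\<close>: \<open>kap_eq_integral\<close> and \<open>heis_ker_left_mult\<close> exhibit
  \<open>heis_ker (x\<inverse> z)\<close> as the inner product of \<open>wave x\<close> and \<open>wave z\<close>.\<close>

definition wave :: "heis \<Rightarrow> real \<Rightarrow> real \<Rightarrow> complex" where
  "wave x h u = of_real (chi (u - fst x)) * unit_char (- (h * phase x u))"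

lemma norm_wave_le: "cmod (wave x h u) \<le> 1"
  by (simp add: wave_def norm_mult indicator_def)

lemma borel_measurable_wave [measurable]:
  "(\<lambda>(h, u). wave x h (u + m)) \<in> borel_measurable (borel \<Otimes>\<^sub>M borel)"
  "wave x h \<in> borel_measurable borel"
  unfolding wave_def by measurable

section \<open>Kernel values at lattice points as Fourier coefficients\<close>

fun lattice_point :: "int \<times> int \<times> int \<Rightarrow> heis" where
  "lattice_point (m, k, l) = (of_int m, of_int k, of_int l + of_int m * of_int k / 2)"

lemma bij_lattice_point: "bij_betw lattice_point UNIV heis_lattice"
proof (rule bij_betw_imageI)
  show "inj lattice_point" by (rule injI) (auto elim!: lattice_point.elims)
  show "range lattice_point = heis_lattice"
    unfolding heis_lattice_def by (auto simp: image_iff split_paired_Ex) 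
qed

text \<open>Brings the kernel values into the form that \<open>parseval_shear\<close> sums. The
  integral over u is moved to the m-th unit interval, \<open>kap\<close> is expanded as an integral
  over h, and the two integrations are exchanged, which boundedness on a product of finite measures
  justifies.\<close>

lemma heis_ker_lattice:
  "of_real (heis_ker (heis_mult (heis_inv x) (lattice_point (m, k, l)))) =
    (\<integral> h. (wt h * (\<integral> u. wave x h (u + of_int m) * unit_char (- (h * of_int k * u)) \<partial>cell)) *
      unit_char (of_int l * h) \<partial>cell)"
proof -
  let ?\<gamma> = "lattice_point (m, k, l)"
  let ?f = "\<lambda>h u. of_real (wt h) * wave x h (u + of_int m) * unit_char (- (h * of_int k * u)) * unit_char (of_int l * h)"
  interpret pair_sigma_finite cell cell ..
  interpret P: finite_measure "cell \<Otimes>\<^sub>M cell"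
    by (rule finite_measure_pair_measure) unfold_locales
  have f: "integrable (cell \<Otimes>\<^sub>M cell) (case_prod ?f)"
  proof (rule P.integrable_const_bound[where B = 1])
    show "AE z in cell \<Otimes>\<^sub>M cell. norm (case_prod ?f z) \<le> 1"
    proof (rule AE_I2)
      fix z
      show "norm (case_prod ?f z) \<le> 1"
        using mult_mono[of "wt (fst z)" 1 "cmod (wave x (fst z) (snd z + of_int m))" 1]
          wt_le[of "fst z"] wt_nonneg[of "fst z"] norm_wave_le[of x "fst z" "snd z + of_int m"]
        by (simp add: split_def norm_mult)
    qed
  qed measurable
  have "complex_of_real (heis_ker (heis_mult (heis_inv x) ?\<gamma>))
      = of_real (\<integral> u. chi u * (chi (u + of_int m - fst x) * kap (phase ?\<gamma> (u + of_int m) - phase x (u + of_int m))) \<partial>lborel)"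
    unfolding heis_ker_left_mult
    by (subst lborel_integral_real_affine[where c = 1 and t = "of_int m"], simp) (simp add: algebra_simps)
  also have "\<dots> = of_real (\<integral> u. chi (u + of_int m - fst x) * kap (phase ?\<gamma> (u + of_int m) - phase x (u + of_int m)) \<partial>cell)"
    by (subst integral_cell) (simp_all del: lattice_point.simps)
  also have "\<dots> = (\<integral> u. (\<integral> h. ?f h u \<partial>cell) \<partial>cell)"
    unfolding integral_complex_of_real[symmetric]
  proof (rule Bochner_Integration.integral_cong[OF refl])
    fix u
    let ?s = "phase ?\<gamma> (u + of_int m) - phase x (u + of_int m)"
    \<comment> \<open>The terms with m k cancel here, so the exponential factors into a character in
      l h and one in k h u.\<close>
    have s: "?s = of_int l - of_int k * u - phase x (u + of_int m)" by (simp add: field_simps)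
    have "unit_char (h * ?s) = unit_char (- (h * phase x (u + of_int m))) * unit_char (- (h * of_int k * u)) * unit_char (of_int l * h)" for h
      unfolding s by (simp flip: unit_char_add add: algebra_simps)
    then have "(\<lambda>h. ?f h u) = (\<lambda>h. of_real (chi (u + of_int m - fst x)) * (of_real (wt h) * unit_char (h * ?s)))"
      by (simp add: wave_def mult_ac)
    then show "of_real (chi (u + of_int m - fst x) * kap ?s) = (\<integral> h. ?f h u \<partial>cell)"
      by (simp only: integral_mult_right_zero kap_eq_integral of_real_mult)
  qed
  also have "\<dots> = (\<integral> h. (\<integral> u. ?f h u \<partial>cell) \<partial>cell)"
    by (rule Fubini_integral[OF f])
  also have "\<dots> = (\<integral> h. (wt h * (\<integral> u. wave x h (u + of_int m) * unit_char (- (h * of_int k * u)) \<partial>cell)) *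
      unit_char (of_int l * h) \<partial>cell)"
  proof (rule Bochner_Integration.integral_cong[OF refl])
    fix h
    have "(\<lambda>u. ?f h u) = (\<lambda>u. (of_real (wt h) * (wave x h (u + of_int m) * unit_char (- (h * of_int k * u)))) *
        unit_char (of_int l * h))"
      by (simp add: mult_ac)
    then show "(\<integral> u. ?f h u \<partial>cell) = (wt h * (\<integral> u. wave x h (u + of_int m) *
        unit_char (- (h * of_int k * u)) \<partial>cell)) * unit_char (of_int l * h)"
      by (simp only: integral_mult_left_zero integral_mult_right_zero)
  qed
  finally show ?thesis .
qed

text \<open>The cosine is the real part of the product of one exponential with the conjugate of the
  other. Integrated against \<open>wt\<close> it becomes \<open>kap\<close> of the difference of the
  exponents, as in \<open>heis_ker_left_mult\<close>.\<close>

lemma norm_wave_add_square: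
  "(cmod (wave x h u + wave y h u))\<^sup>2 = chi (u - fst x) + chi (u - fst y)
    + 2 * (chi (u - fst x) * chi (u - fst y) * cos (2 * pi * (h * (phase y u - phase x u))))"
proof -
  have "2 * pi * (h * (phase y u - phase x u)) = 2 * pi * (h * phase y u) - 2 * pi * (h * phase x u)"
    by (simp add: algebra_simps)
  then have c: "cos (2 * pi * (h * (phase y u - phase x u))) =
      cos (2 * pi * (h * phase y u)) * cos (2 * pi * (h * phase x u)) + sin (2 * pi * (h * phase y u)) * sin (2 * pi * (h * phase x u))"
    by (simp add: cos_diff)
  have sc: "(sin a)\<^sup>2 = 1 - (cos a)\<^sup>2" for a :: real by (simp add: sin_squared_eq)
  show ?thesis
    unfolding c cmod_power2
    by (cases "u - fst x \<in> {-1/2..<1/2}"; cases "u - fst y \<in> {-1/2..<1/2}")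
      (simp_all add: wave_def unit_char_def indicator_def power2_sum power2_diff sc algebra_simps del: atLeastLessThan_iff)
qed

lemma heis_ker_0 [simp]: "heis_ker (0, 0, 0) = 1/4"
proof -
  have "complex_of_real (heis_ker (0, 0, 0)) = of_real (1/4)"
    by (simp flip: heis_sinc_eq_ker add: nsinc_def)
  then show ?thesis by (simp only: of_real_eq_iff)
qed

lemma integral_chi_shift: "(\<integral> u. chi (u - p) \<partial>lborel) = 1"
  by (subst lborel_integral_real_affine[where c = 1 and t = p]) simp_all

text \<open>The bound, attained at the neutral element, makes 1/2 + 2 \<open>heis_ker z\<close>
  nonnegative, so that this value is recovered faithfully from \<open>ennreal\<close>.\<close>

lemma abs_heis_ker_le: "\<bar>heis_ker z\<bar> \<le> 1/4"
proof -
  have "norm (\<integral> u. chi u * chi (u - fst z) * kap (phase z u) \<partial>lborel) \<le> (\<integral> u. 1/4 * chi (u - fst z) \<partial>lborel)"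
  proof (rule order_trans[OF integral_norm_bound Bochner_Integration.integral_mono'])
    show "norm (chi u * chi (u - fst z) * kap (phase z u)) \<le> 1/4 * chi (u - fst z)" for u
      using abs_kap_le[of "phase z u"] by (simp add: indicator_def)
    show "integrable lborel (\<lambda>u. 1/4 * chi (u - fst z))"
      using integrable_chi_mult[of "\<lambda>_. 1" 1 "fst z"] by simp
  qed simp
  then show ?thesis unfolding heis_ker_def using integral_chi_shift[of "fst z"] by simp
qed

text \<open>Summing over the squares of sums instead of products keeps all terms nonnegative.\<close>

proposition lattice_sum_heis_ker:
  "(\<integral>\<^sup>+ \<gamma>. ennreal ((heis_ker (heis_mult (heis_inv x) \<gamma>) + heis_ker (heis_mult (heis_inv y) \<gamma>))\<^sup>2) \<partial>count_space heis_lattice)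
    = ennreal (1/2 + 2 * heis_ker (heis_mult (heis_inv x) y))"
proof -
  define s where "s = (\<lambda>\<gamma>. ennreal ((heis_ker (heis_mult (heis_inv x) \<gamma>) + heis_ker (heis_mult (heis_inv y) \<gamma>))\<^sup>2))"
  define a where "a = (\<lambda>h u. wave x h u + wave y h u)"
  let ?c = "\<lambda>m k l. (\<integral> h. (wt h * (\<integral> u. a h (u + of_int m) * unit_char (- (h * of_int k * u)) \<partial>cell)) *
      unit_char (of_int l * h) \<partial>cell)"
  interpret LC: pair_sigma_finite cell "lborel :: real measure" ..
  have am [measurable]: "(\<lambda>(h, u). a h (u + c)) \<in> borel_measurable (borel \<Otimes>\<^sub>M borel)" for c
    unfolding a_def by measurable
  have am0 [measurable]: "case_prod a \<in> borel_measurable (borel \<Otimes>\<^sub>M borel)"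
    using am[of 0] by simp
  have am1 [measurable]: "a h \<in> borel_measurable borel" for h
    unfolding a_def by measurable
  have aB: "cmod (a h u) \<le> 2" for h u
    unfolding a_def using norm_triangle_ineq[of "wave x h u" "wave y h u"] norm_wave_le[of x h u] norm_wave_le[of y h u]
    by linarith
  \<comment> \<open>By linearity the sum of the two kernel values is the coefficient of the sum of
    the two waves, to which Parseval's identity applies once.\<close>
  have s: "s (lattice_point (m, k, l)) = ennreal ((cmod (?c m k l))\<^sup>2)" for m k l
  proof -
    have i: "integrable cell (\<lambda>u. wave x h (u + of_int m) * unit_char (- (h * of_int k * u)))" for x h
      by (rule integrable_cell_bounded[where B = 1]) (auto simp: norm_mult norm_wave_le)
    have i': "integrable cell (\<lambda>h. (wt h * (\<integral> u. wave x h (u + of_int m) * unit_char (- (h * of_int k * u)) \<partial>cell)) * unit_char (of_int l * h))" for x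
    proof (rule integrable_cell_bounded[where B = 1])
      fix h
      have "cmod (\<integral> u. wave x h (u + of_int m) * unit_char (- (h * of_int k * u)) \<partial>cell) \<le> (\<integral> u. 1 \<partial>cell)"
        by (rule order_trans[OF integral_norm_bound Bochner_Integration.integral_mono])
          (intro integrable_norm i | simp add: norm_mult norm_wave_le)+
      then show "cmod ((wt h * (\<integral> u. wave x h (u + of_int m) * unit_char (- (h * of_int k * u)) \<partial>cell)) * unit_char (of_int l * h)) \<le> 1"
        using wt_le[of h] wt_nonneg[of h] mult_mono[of "wt h" 1 _ 1] by (simp add: norm_mult)
    qed measurable
    have "?c m k l = (\<integral> h. (wt h * (\<integral> u. wave x h (u + of_int m) * unit_char (- (h * of_int k * u)) \<partial>cell)) * unit_char (of_int l * h)
       + (wt h * (\<integral> u. wave y h (u + of_int m) * unit_char (- (h * of_int k * u)) \<partial>cell)) * unit_char (of_int l * h) \<partial>cell)"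
      by (rule Bochner_Integration.integral_cong) (simp_all add: a_def ring_distribs i)
    also have "\<dots> = of_real (heis_ker (heis_mult (heis_inv x) (lattice_point (m, k, l))) + heis_ker (heis_mult (heis_inv y) (lattice_point (m, k, l))))"
      unfolding of_real_add heis_ker_lattice by (rule Bochner_Integration.integral_add[OF i' i'])
    finally show ?thesis unfolding s_def by (simp only: norm_of_real power2_abs)
  qed
  \<comment> \<open>The integral over h for fixed u: each 1/4 is the mass of \<open>wt\<close>, and
    the cross term has turned into \<open>kap\<close>.\<close>
  define F where "F = (\<lambda>u. 1/4 * chi (u - fst x) + 1/4 * chi (u - fst y)
      + 2 * (chi (u - fst x) * chi (u - fst y) * kap (phase y u - phase x u)))"
  have F: "(\<integral>\<^sup>+ h. ennreal (wt h * (cmod (a h u))\<^sup>2) \<partial>cell) = ennreal (F u)" "F u \<ge> 0" for u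
  proof -
    let ?X = "chi (u - fst x)" and ?Y = "chi (u - fst y)" and ?s = "phase y u - phase x u"
    have i1: "integrable cell wt"
      by (rule integrable_cell_bounded[where B = 1]) (auto simp: wt_le wt_nonneg)
    have i2: "integrable cell (\<lambda>h. wt h * cos (2 * pi * (h * ?s)))"
    proof (rule integrable_cell_bounded)
      show "norm (wt h * cos (2 * pi * (h * ?s))) \<le> 1 * 1" for h
        unfolding norm_mult by (rule mult_mono) (auto simp: wt_nonneg wt_le)
    qed measurable
    have w: "(\<integral> h. wt h \<partial>cell) = 1/4"
      using kap_eq_integral_cos[of 0] by (simp add: kap_def nsinc_def)
    have eq: "wt h * (cmod (a h u))\<^sup>2 = (?X + ?Y) * wt h + (2 * ?X * ?Y) * (wt h * cos (2 * pi * (h * ?s)))" for h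
      unfolding a_def norm_wave_add_square by (simp add: algebra_simps)
    have F: "(\<integral> h. wt h * (cmod (a h u))\<^sup>2 \<partial>cell) = F u"
      unfolding eq
      by (subst Bochner_Integration.integral_add[OF integrable_mult_right integrable_mult_right, OF i1 i2])
        (simp only: integral_mult_right_zero w kap_eq_integral_cos, simp add: F_def algebra_simps)
    have "(\<integral>\<^sup>+ h. ennreal (wt h * (cmod (a h u))\<^sup>2) \<partial>cell) = ennreal (\<integral> h. wt h * (cmod (a h u))\<^sup>2 \<partial>cell)"
    proof (rule nn_integral_eq_integral)
      show "integrable cell (\<lambda>h. wt h * (cmod (a h u))\<^sup>2)"
        unfolding eq by (intro Bochner_Integration.integrable_add integrable_mult_right i1 i2)
    qed (simp add: wt_nonneg)
    then show "(\<integral>\<^sup>+ h. ennreal (wt h * (cmod (a h u))\<^sup>2) \<partial>cell) = ennreal (F u)" by (simp only: F)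
    show "F u \<ge> 0" unfolding F[symmetric] by (rule Bochner_Integration.integral_nonneg) (simp add: wt_nonneg)
  qed
  have F_integral: "has_bochner_integral lborel F (1/2 + 2 * heis_ker (heis_mult (heis_inv x) y))"
  proof -
    have i1: "has_bochner_integral lborel (\<lambda>u. chi (u - p)) 1" for p
      using integrable_chi_mult[of "\<lambda>_. 1" 1 p] integral_chi_shift[of p] by (simp add: has_bochner_integral_iff)
    have "integrable lborel (\<lambda>u. chi (u - fst x) * (chi (u - fst y) * kap (phase y u - phase x u)))"
    proof (rule integrable_chi_mult)
      show "\<bar>chi (u - fst y) * kap (phase y u - phase x u)\<bar> \<le> 1/4" for u
        using abs_kap_le[of "phase y u - phase x u"] by (simp add: indicator_def)
    qed measurable
    then have i2: "has_bochner_integral lborel (\<lambda>u. chi (u - fst x) * chi (u - fst y) * kap (phase y u - phase x u))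
        (heis_ker (heis_mult (heis_inv x) y))"
      by (simp add: has_bochner_integral_iff heis_ker_left_mult mult.assoc)
    have "has_bochner_integral lborel F (1/4 * 1 + 1/4 * 1 + 2 * heis_ker (heis_mult (heis_inv x) y))"
      unfolding F_def by (intro has_bochner_integral_add has_bochner_integral_mult_right i1 i2)
    then show ?thesis by simp
  qed
  have "(\<integral>\<^sup>+ \<gamma>. s \<gamma> \<partial>count_space heis_lattice) = (\<integral>\<^sup>+ i. s (lattice_point i) \<partial>count_space UNIV)"
    by (rule nn_integral_bij_count_space[OF bij_lattice_point, symmetric])
  also have "\<dots> = (\<integral>\<^sup>+ m. \<integral>\<^sup>+ k. \<integral>\<^sup>+ l. s (lattice_point (m, k, l)) \<partial>count_space UNIV \<partial>count_space UNIV \<partial>count_space UNIV)"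
    by (subst nn_integral_fst_count_space[symmetric], subst nn_integral_fst_count_space[symmetric]) (rule refl)
  also have "\<dots> = (\<integral>\<^sup>+ m. \<integral>\<^sup>+ h. ennreal (wt h) * (\<integral>\<^sup>+ u. ennreal ((cmod (a h (u + of_int m)))\<^sup>2) \<partial>cell) \<partial>cell \<partial>count_space UNIV)"
    unfolding s by (intro nn_integral_cong parseval_shear[where B = 2]) (auto intro: aB)
  also have "\<dots> = (\<integral>\<^sup>+ h. \<integral>\<^sup>+ m. ennreal (wt h) * (\<integral>\<^sup>+ u. ennreal ((cmod (a h (u + of_int m)))\<^sup>2) \<partial>cell) \<partial>count_space UNIV \<partial>cell)"
    by (rule nn_integral_count_space_nn_integral[symmetric]) auto
  \<comment> \<open>The weight does not depend on m, and the unit intervals of the variable u fill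
    the line.\<close>
  also have "\<dots> = (\<integral>\<^sup>+ h. ennreal (wt h) * (\<integral>\<^sup>+ u. ennreal ((cmod (a h u))\<^sup>2) \<partial>lborel) \<partial>cell)"
    by (subst nn_integral_cmult, simp, subst nn_integral_tile) auto
  also have "\<dots> = (\<integral>\<^sup>+ h. \<integral>\<^sup>+ u. ennreal (wt h * (cmod (a h u))\<^sup>2) \<partial>lborel \<partial>cell)"
    by (simp add: nn_integral_cmult ennreal_mult wt_nonneg)
  also have "\<dots> = (\<integral>\<^sup>+ u. \<integral>\<^sup>+ h. ennreal (wt h * (cmod (a h u))\<^sup>2) \<partial>cell \<partial>lborel)"
    by (rule LC.Fubini'[symmetric]) measurable
  also have "\<dots> = (\<integral>\<^sup>+ u. ennreal (F u) \<partial>lborel)"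
    using F by simp
  also have "\<dots> = ennreal (\<integral> u. F u \<partial>lborel)"
    using F(2) F_integral by (intro nn_integral_eq_integral) (auto simp: has_bochner_integral_iff)
  also have "(\<integral> u. F u \<partial>lborel) = 1/2 + 2 * heis_ker (heis_mult (heis_inv x) y)"
    using F_integral by (simp add: has_bochner_integral_iff)
  finally show ?thesis unfolding s_def .
qed

section \<open>From the lattice to the group\<close>

lemma isCont_chi: "x \<noteq> -1/2 \<Longrightarrow> x \<noteq> 1/2 \<Longrightarrow> isCont chi x"
  by (auto simp: isCont_indicator frontier_def)

text \<open>Dominated convergence along sequences: the translated indicator at the limit point jumps
  at just two values of u, and the integrands stay below a quarter of \<open>chi\<close>.\<close>

lemma continuous_on_heis_ker: "continuous_on UNIV heis_ker"
  unfolding continuous_on_sequentially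
proof (intro allI ballI impI, elim conjE)
  fix X :: "nat \<Rightarrow> heis" and z assume X: "X \<longlonglongrightarrow> z"
  show "(heis_ker \<circ> X) \<longlonglongrightarrow> heis_ker z"
    unfolding heis_ker_def comp_def
  proof (rule integral_dominated_convergence[where w = "\<lambda>u. 1/4 * chi u"])
    have "AE u in lborel. u \<noteq> fst z - 1/2 \<and> u \<noteq> fst z + 1/2"
      using AE_lborel_singleton[of "fst z - 1/2"] AE_lborel_singleton[of "fst z + 1/2"]
      by eventually_elim simp
    then show "AE u in lborel. (\<lambda>n. chi u * chi (u - fst (X n)) * kap (phase (X n) u)) \<longlonglongrightarrow>
        chi u * chi (u - fst z) * kap (phase z u)"
    proof eventually_elim
      case (elim u)
      have phase_eq: "phase y u = snd (snd y) + fst y * fst (snd y) / 2 - fst (snd y) * u" for y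
        by (cases y) simp
      have "(\<lambda>n. chi (u - fst (X n))) \<longlonglongrightarrow> chi (u - fst z)"
        by (rule isCont_tendsto_compose[OF isCont_chi]) (use elim in \<open>auto intro!: tendsto_intros X\<close>)
      moreover have "(\<lambda>n. kap (phase (X n) u)) \<longlonglongrightarrow> kap (phase z u)"
      proof -
        have kap: "isCont kap (phase z u)"
          using continuous_on_kap[OF continuous_on_id, of UNIV]
          by (simp add: continuous_on_eq_continuous_at)
        have "(\<lambda>n. phase (X n) u) \<longlonglongrightarrow> phase z u"
          unfolding phase_eq by (intro tendsto_intros X) auto
        then show ?thesis by (rule isCont_tendsto_compose[OF kap])
      qed
      ultimately show ?case by (intro tendsto_intros)
    qed
    show "AE u in lborel. norm (chi u * chi (u - fst (X n)) * kap (phase (X n) u)) \<le> 1/4 * chi u" for n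
      using abs_kap_le by (intro AE_I2) (simp add: indicator_def)
    show "integrable lborel (\<lambda>u. 1/4 * chi u)"
      using integrable_chi_mult[of "\<lambda>_. 1" 1 0] by simp
  qed measurable
qed

section \<open>Integration over the group by means of the lattice\<close>

lemma heis_mult_eq: "heis_mult x y = (fst x + fst y, fst (snd x) + fst (snd y),
    snd (snd x) + snd (snd y) + (fst x * fst (snd y) - fst (snd x) * fst y) / 2)"
  by (cases x; cases y) simp

lemma continuous_on_heis_mult [continuous_intros]:
  "continuous_on A f \<Longrightarrow> continuous_on A g \<Longrightarrow> continuous_on A (\<lambda>x. heis_mult (f x) (g x))"
  unfolding heis_mult_eq by (intro continuous_intros) auto

lemma heis_inv_mult: "heis_inv (heis_mult x y) = heis_mult (heis_inv y) (heis_inv x)"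
  by (cases x; cases y) (simp add: diff_divide_distrib algebra_simps)

lemma heis_inv_inv [simp]: "heis_inv (heis_inv x) = x"
  by (cases x) simp

lemma heis_mult_cancel: "heis_mult x (heis_mult (heis_inv x) y) = y" "heis_mult (heis_inv x) (heis_mult x y) = y"
  by (simp_all flip: heis_mult_assoc add: heis_mult_inv heis_mult_unit)

lemma borel_measurable_heis_ker_translate [measurable]:
  "(\<lambda>z. heis_ker (heis_mult x z)) \<in> borel_measurable borel"
  by (intro borel_measurable_continuous_onI continuous_on_compose2[OF continuous_on_heis_ker] continuous_intros) auto

lemma nn_integral_triple:
  assumes "sigma_finite_measure M2" "sigma_finite_measure M3"
    and [measurable]: "f \<in> borel_measurable (M1 \<Otimes>\<^sub>M (M2 \<Otimes>\<^sub>M M3))"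
  shows "(\<integral>\<^sup>+ a. \<integral>\<^sup>+ b. \<integral>\<^sup>+ c. f (a, b, c) \<partial>M3 \<partial>M2 \<partial>M1) = (\<integral>\<^sup>+ z. f z \<partial>(M1 \<Otimes>\<^sub>M (M2 \<Otimes>\<^sub>M M3)))"
proof -
  interpret M2: sigma_finite_measure M2 by fact
  interpret M3: sigma_finite_measure M3 by fact
  interpret M23: pair_sigma_finite M2 M3 ..
  have "(\<integral>\<^sup>+ b. \<integral>\<^sup>+ c. f (a, b, c) \<partial>M3 \<partial>M2) = (\<integral>\<^sup>+ y. f (a, y) \<partial>(M2 \<Otimes>\<^sub>M M3))" if "a \<in> space M1" for a
    using that by (intro M3.nn_integral_fst) measurable
  then have "(\<integral>\<^sup>+ a. \<integral>\<^sup>+ b. \<integral>\<^sup>+ c. f (a, b, c) \<partial>M3 \<partial>M2 \<partial>M1) = (\<integral>\<^sup>+ a. \<integral>\<^sup>+ y. f (a, y) \<partial>(M2 \<Otimes>\<^sub>M M3) \<partial>M1)"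
    by (rule nn_integral_cong)
  also have "\<dots> = (\<integral>\<^sup>+ z. f z \<partial>(M1 \<Otimes>\<^sub>M (M2 \<Otimes>\<^sub>M M3)))"
    by (rule M23.nn_integral_fst) fact
  finally show ?thesis .
qed

text \<open>Right multiplication by a lattice point moves the first two coordinates by m and k, and
  the third by l plus a shear that depends on m, k, a, b but not on c. So the line can be tiled in
  each coordinate separately, the innermost one after a translation by the shear.\<close>

lemma nn_integral_lattice_tiling:
  fixes G :: "heis \<Rightarrow> ennreal"
  assumes G [measurable]: "G \<in> borel_measurable borel"
  shows "(\<integral>\<^sup>+ z. G z \<partial>lborel) =
    (\<integral>\<^sup>+ w. \<integral>\<^sup>+ \<gamma>. G (heis_mult w \<gamma>) \<partial>count_space heis_lattice \<partial>(cell \<Otimes>\<^sub>M (cell \<Otimes>\<^sub>M cell)))"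
proof -
  let ?C = "count_space (UNIV :: int set)"
  have borel3: "borel = (borel \<Otimes>\<^sub>M (borel \<Otimes>\<^sub>M borel) :: heis measure)" by (simp add: borel_prod)
  have G3 [measurable]: "(\<lambda>(a, b, c). G (a, b, c)) \<in> borel_measurable (borel \<Otimes>\<^sub>M (borel \<Otimes>\<^sub>M borel))"
    using G unfolding borel3 by (simp add: split_def)
  have lb: "(lborel :: heis measure) = lborel \<Otimes>\<^sub>M (lborel \<Otimes>\<^sub>M lborel)" by (simp add: lborel_prod)
  define g where "g = (\<lambda>i w. G (heis_mult w (lattice_point i)))"
  have g3: "g (m, k, l) (a, b, c) = G (a + of_int m, b + of_int k,
      (c + of_int l) + (of_int m * of_int k / 2 + (a * of_int k - b * of_int m) / 2))" for m k l a b c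
    by (simp add: g_def algebra_simps)
  have "(\<lambda>(a, b, c). g i (a, b, c)) \<in> borel_measurable (borel \<Otimes>\<^sub>M (borel \<Otimes>\<^sub>M borel))" for i
    by (cases i) (simp add: g3)
  then have g_meas [measurable]: "g i \<in> borel_measurable (borel \<Otimes>\<^sub>M (borel \<Otimes>\<^sub>M borel))" for i
    by (simp add: split_def)
  have inner: "(\<integral>\<^sup>+ z. G (a + of_int m, b + of_int k, z) \<partial>lborel) = (\<integral>\<^sup>+ l. \<integral>\<^sup>+ c. g (m, k, l) (a, b, c) \<partial>cell \<partial>?C)" for a b m k
  proof -
    let ?s = "of_int m * of_int k / 2 + (a * of_int k - b * of_int m) / 2 :: real"
    have "(\<integral>\<^sup>+ z. G (a + of_int m, b + of_int k, z) \<partial>lborel) = (\<integral>\<^sup>+ z. G (a + of_int m, b + of_int k, z + ?s) \<partial>lborel)"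
      by (subst nn_integral_real_affine[where c = 1 and t = ?s]) (simp_all add: add.commute)
    also have "\<dots> = (\<integral>\<^sup>+ l. \<integral>\<^sup>+ c. G (a + of_int m, b + of_int k, (c + of_int l) + ?s) \<partial>cell \<partial>?C)"
      by (rule nn_integral_tile[symmetric]) measurable
    finally show ?thesis unfolding g3 .
  qed
  have "(\<integral>\<^sup>+ z. G z \<partial>lborel) = (\<integral>\<^sup>+ a. \<integral>\<^sup>+ b. \<integral>\<^sup>+ c. G (a, b, c) \<partial>lborel \<partial>lborel \<partial>lborel)"
    unfolding lb
    using G3 by (intro nn_integral_triple[symmetric] lborel.sigma_finite_measure_axioms) (simp add: split_def)
  also have "\<dots> = (\<integral>\<^sup>+ m. \<integral>\<^sup>+ a. \<integral>\<^sup>+ b. \<integral>\<^sup>+ c. G (a + of_int m, b, c) \<partial>lborel \<partial>lborel \<partial>cell \<partial>?C)"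
    by (rule nn_integral_tile[symmetric]) measurable
  also have "\<dots> = (\<integral>\<^sup>+ m. \<integral>\<^sup>+ a. \<integral>\<^sup>+ k. \<integral>\<^sup>+ b. \<integral>\<^sup>+ c. G (a + of_int m, b + of_int k, c) \<partial>lborel \<partial>cell \<partial>?C \<partial>cell \<partial>?C)"
    by (intro nn_integral_cong nn_integral_tile[symmetric]) measurable
  also have "\<dots> = (\<integral>\<^sup>+ m. \<integral>\<^sup>+ k. \<integral>\<^sup>+ a. \<integral>\<^sup>+ b. \<integral>\<^sup>+ c. G (a + of_int m, b + of_int k, c) \<partial>lborel \<partial>cell \<partial>cell \<partial>?C \<partial>?C)"
    by (intro nn_integral_cong nn_integral_count_space_nn_integral) simp_all
  also have "\<dots> = (\<integral>\<^sup>+ m. \<integral>\<^sup>+ k. \<integral>\<^sup>+ a. \<integral>\<^sup>+ b. \<integral>\<^sup>+ l. \<integral>\<^sup>+ c. g (m, k, l) (a, b, c) \<partial>cell \<partial>?C \<partial>cell \<partial>cell \<partial>?C \<partial>?C)"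
    unfolding inner ..
  also have "\<dots> = (\<integral>\<^sup>+ m. \<integral>\<^sup>+ k. \<integral>\<^sup>+ a. \<integral>\<^sup>+ l. \<integral>\<^sup>+ b. \<integral>\<^sup>+ c. g (m, k, l) (a, b, c) \<partial>cell \<partial>cell \<partial>?C \<partial>cell \<partial>?C \<partial>?C)"
    by (intro nn_integral_cong nn_integral_count_space_nn_integral) simp_all
  also have "\<dots> = (\<integral>\<^sup>+ m. \<integral>\<^sup>+ k. \<integral>\<^sup>+ l. \<integral>\<^sup>+ a. \<integral>\<^sup>+ b. \<integral>\<^sup>+ c. g (m, k, l) (a, b, c) \<partial>cell \<partial>cell \<partial>cell \<partial>?C \<partial>?C \<partial>?C)"
    by (intro nn_integral_cong nn_integral_count_space_nn_integral) simp_all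
  also have "\<dots> = (\<integral>\<^sup>+ i. \<integral>\<^sup>+ a. \<integral>\<^sup>+ b. \<integral>\<^sup>+ c. g i (a, b, c) \<partial>cell \<partial>cell \<partial>cell \<partial>count_space UNIV)"
    by (rule sym, subst nn_integral_fst_count_space[symmetric], subst nn_integral_fst_count_space[symmetric]) (rule refl)
  also have "\<dots> = (\<integral>\<^sup>+ i. \<integral>\<^sup>+ w. g i w \<partial>(cell \<Otimes>\<^sub>M (cell \<Otimes>\<^sub>M cell)) \<partial>count_space UNIV)"
    using g_meas by (intro nn_integral_cong nn_integral_triple cell.sigma_finite_measure_axioms) (simp add: split_def)
  also have "\<dots> = (\<integral>\<^sup>+ w. \<integral>\<^sup>+ i. g i w \<partial>count_space UNIV \<partial>(cell \<Otimes>\<^sub>M (cell \<Otimes>\<^sub>M cell)))"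
    by (rule nn_integral_count_space_nn_integral[symmetric]) (use g_meas in \<open>simp_all add: split_def\<close>)
  also have "\<dots> = (\<integral>\<^sup>+ w. \<integral>\<^sup>+ \<gamma>. G (heis_mult w \<gamma>) \<partial>count_space heis_lattice \<partial>(cell \<Otimes>\<^sub>M (cell \<Otimes>\<^sub>M cell)))"
    unfolding g_def by (rule nn_integral_cong) (rule nn_integral_bij_count_space[OF bij_lattice_point])
  finally show ?thesis .
qed

text \<open>Moving the cube variable w into the arguments replaces x and y by their left translates
  under the inverse of w. The lattice sum depends on these only through
  \<open>heis_mult (heis_inv x) y\<close>, which is unchanged, so the integrand is constant over a
  cube of mass one.\<close>

lemma nn_integral_heis_ker:
  "(\<integral>\<^sup>+ z. ennreal ((heis_ker (heis_mult (heis_inv x) z) + heis_ker (heis_mult (heis_inv y) z))\<^sup>2) \<partial>lborel)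
    = ennreal (1/2 + 2 * heis_ker (heis_mult (heis_inv x) y))"
proof -
  have move: "heis_mult (heis_inv x) (heis_mult w \<gamma>) = heis_mult (heis_inv (heis_mult (heis_inv w) x)) \<gamma>" for x w \<gamma>
    by (simp add: heis_inv_mult heis_mult_assoc)
  have "(\<integral>\<^sup>+ z. ennreal ((heis_ker (heis_mult (heis_inv x) z) + heis_ker (heis_mult (heis_inv y) z))\<^sup>2) \<partial>lborel)
    = (\<integral>\<^sup>+ w. \<integral>\<^sup>+ \<gamma>. ennreal ((heis_ker (heis_mult (heis_inv x) (heis_mult w \<gamma>)) +
        heis_ker (heis_mult (heis_inv y) (heis_mult w \<gamma>)))\<^sup>2) \<partial>count_space heis_lattice \<partial>(cell \<Otimes>\<^sub>M (cell \<Otimes>\<^sub>M cell)))"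
    by (rule nn_integral_lattice_tiling) measurable
  also have "\<dots> = (\<integral>\<^sup>+ w. ennreal (1/2 + 2 * heis_ker (heis_mult (heis_inv x) y)) \<partial>(cell \<Otimes>\<^sub>M (cell \<Otimes>\<^sub>M cell)))"
    unfolding move lattice_sum_heis_ker by (simp add: heis_inv_mult heis_mult_assoc heis_mult_cancel)
  also have "\<dots> = ennreal (1/2 + 2 * heis_ker (heis_mult (heis_inv x) y))"
  proof -
    have "(\<integral>\<^sup>+ w. c \<partial>(cell \<Otimes>\<^sub>M (cell \<Otimes>\<^sub>M cell))) = c" for c
      by (subst nn_integral_triple[symmetric]) (simp_all add: cell.sigma_finite_measure_axioms)
    then show ?thesis .
  qed
  finally show ?thesis .
qed

section \<open>Square-integrable functions\<close>

lemma L2_measurable [measurable_dest]: "f \<in> L2 \<Longrightarrow> f \<in> borel_measurable borel"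
  by (simp add: L2_def)

lemma L2_integrable: "f \<in> L2 \<Longrightarrow> integrable lborel (\<lambda>x. (cmod (f x))\<^sup>2)"
  by (simp add: L2_def)

lemma L2_integrable_bound:
  assumes "f \<in> borel_measurable borel" "integrable lborel g" "\<And>x. (cmod (f x))\<^sup>2 \<le> g x"
  shows "f \<in> L2"
proof -
  have "integrable lborel (\<lambda>x. (cmod (f x))\<^sup>2)"
  proof (rule Bochner_Integration.integrable_bound[OF assms(2)])
    show "AE x in lborel. norm ((cmod (f x))\<^sup>2) \<le> norm (g x)"
      by (rule AE_I2) (simp add: order_trans[OF assms(3) abs_ge_self])
  qed (use assms(1) in measurable)
  then show ?thesis using assms(1) by (simp add: L2_def)
qed

lemma L2_zero: "(\<lambda>x. 0) \<in> L2"
  by (simp add: L2_def)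

lemma L2_add:
  assumes "f \<in> L2" "g \<in> L2"
  shows "(\<lambda>x. f x + g x) \<in> L2"
proof (rule L2_integrable_bound)
  show "integrable lborel (\<lambda>x. 2 * (cmod (f x))\<^sup>2 + 2 * (cmod (g x))\<^sup>2)"
    using assms by (intro Bochner_Integration.integrable_add integrable_mult_right L2_integrable)
  fix x
  have "(cmod (f x + g x))\<^sup>2 \<le> (cmod (f x) + cmod (g x))\<^sup>2"
    by (intro power_mono norm_triangle_ineq) simp
  also have "\<dots> \<le> 2 * (cmod (f x))\<^sup>2 + 2 * (cmod (g x))\<^sup>2"
    using sum_squares_bound[of "cmod (f x)" "cmod (g x)"] by (simp add: power2_sum)
  finally show "(cmod (f x + g x))\<^sup>2 \<le> 2 * (cmod (f x))\<^sup>2 + 2 * (cmod (g x))\<^sup>2" .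
qed (use assms in measurable)

lemma L2_scale:
  assumes "f \<in> L2"
  shows "(\<lambda>x. c * f x) \<in> L2"
  using assms by (auto simp: L2_def norm_mult power_mult_distrib)

lemma L2_diff:
  assumes "f \<in> L2" "g \<in> L2"
  shows "(\<lambda>x. f x - g x) \<in> L2"
  using L2_add[OF assms(1) L2_scale[OF assms(2), of "-1"]] by simp

lemma L2_sum:
  assumes "\<And>i. i \<in> I \<Longrightarrow> f i \<in> L2"
  shows "(\<lambda>x. \<Sum>i\<in>I. f i x) \<in> L2"
  using assms by (induction I rule: infinite_finite_induct) (simp_all add: L2_zero L2_add)

lemma L2_integrable_mult:
  assumes "f \<in> L2" "g \<in> L2"
  shows "integrable lborel (\<lambda>x. f x * cnj (g x))"
proof (rule Bochner_Integration.integrable_bound)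
  show "integrable lborel (\<lambda>x. (cmod (f x))\<^sup>2 + (cmod (g x))\<^sup>2)"
    using assms by (intro Bochner_Integration.integrable_add L2_integrable)
  show "AE x in lborel. norm (f x * cnj (g x)) \<le> norm ((cmod (f x))\<^sup>2 + (cmod (g x))\<^sup>2)"
  proof (rule AE_I2)
    fix x
    have "cmod (f x) * cmod (g x) \<le> 2 * cmod (f x) * cmod (g x)"
      using mult_nonneg_nonneg[of "cmod (f x)" "cmod (g x)"] by simp
    also have "\<dots> \<le> (cmod (f x))\<^sup>2 + (cmod (g x))\<^sup>2" by (rule sum_squares_bound)
    finally show "norm (f x * cnj (g x)) \<le> norm ((cmod (f x))\<^sup>2 + (cmod (g x))\<^sup>2)"
      by (simp add: norm_mult)
  qed
qed (use assms in measurable)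

lemma L2_inner_add_left:
  "f \<in> L2 \<Longrightarrow> g \<in> L2 \<Longrightarrow> h \<in> L2 \<Longrightarrow> L2_inner (\<lambda>x. f x + g x) h = L2_inner f h + L2_inner g h"
  by (simp add: L2_inner_def ring_distribs L2_integrable_mult)

lemma L2_inner_scale_left: "L2_inner (\<lambda>x. c * f x) h = c * L2_inner f h"
  by (simp add: L2_inner_def mult.assoc)

lemma L2_inner_diff_left:
  "f \<in> L2 \<Longrightarrow> g \<in> L2 \<Longrightarrow> h \<in> L2 \<Longrightarrow> L2_inner (\<lambda>x. f x - g x) h = L2_inner f h - L2_inner g h"
  by (simp add: L2_inner_def ring_distribs left_diff_distrib L2_integrable_mult)

lemma L2_inner_sum_left:
  assumes "\<And>i. i \<in> I \<Longrightarrow> f i \<in> L2" "h \<in> L2"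
  shows "L2_inner (\<lambda>x. \<Sum>i\<in>I. f i x) h = (\<Sum>i\<in>I. L2_inner (f i) h)"
  using assms(1) by (induction I rule: infinite_finite_induct)
    (simp_all add: L2_inner_add_left L2_sum assms(2), simp_all add: L2_inner_def)

lemma L2_inner_commute: "L2_inner g f = cnj (L2_inner f g)"
proof -
  have "(\<lambda>x. g x * cnj (f x)) = (\<lambda>x. cnj (f x * cnj (g x)))"
    by (simp add: mult.commute)
  then show ?thesis unfolding L2_inner_def by (simp only: Bochner_Integration.integral_cnj)
qed

lemma L2_inner_add_right:
  "f \<in> L2 \<Longrightarrow> g \<in> L2 \<Longrightarrow> h \<in> L2 \<Longrightarrow> L2_inner h (\<lambda>x. f x + g x) = L2_inner h f + L2_inner h g"
  by (subst (1 2 3) L2_inner_commute) (simp add: L2_inner_add_left)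

lemma L2_inner_scale_right: "L2_inner h (\<lambda>x. c * f x) = cnj c * L2_inner h f"
  by (subst (1 2) L2_inner_commute) (simp add: L2_inner_scale_left)

lemma L2_inner_self: "L2_inner f f = of_real ((L2_norm f)\<^sup>2)"
proof -
  have "L2_inner f f = (\<integral> x. of_real ((cmod (f x))\<^sup>2) \<partial>lborel)"
    unfolding L2_inner_def by (simp add: complex_norm_square del: of_real_power)
  then show ?thesis unfolding integral_complex_of_real L2_norm_def by simp
qed

lemma L2_norm_nonneg [simp]: "L2_norm f \<ge> 0"
  by (simp add: L2_norm_def)

lemma L2_norm_diff_square:
  assumes "f \<in> L2" "g \<in> L2"
  shows "(L2_norm (\<lambda>x. f x - g x))\<^sup>2 = (L2_norm f)\<^sup>2 - 2 * Re (L2_inner f g) + (L2_norm g)\<^sup>2"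
proof -
  let ?d = "\<lambda>x. f x - g x"
  have d: "?d \<in> L2" using assms by (rule L2_diff)
  have "of_real ((L2_norm ?d)\<^sup>2) = L2_inner ?d f - L2_inner ?d g"
    using d assms by (subst L2_inner_self[symmetric], subst (1 2 3) L2_inner_commute)
      (simp add: L2_inner_diff_left)
  also have "\<dots> = of_real ((L2_norm f)\<^sup>2) - cnj (L2_inner f g) - L2_inner f g + of_real ((L2_norm g)\<^sup>2)"
    using assms by (simp add: L2_inner_diff_left L2_inner_self L2_inner_commute[of f g])
  finally have "Re (of_real ((L2_norm ?d)\<^sup>2)) = Re (of_real ((L2_norm f)\<^sup>2) - cnj (L2_inner f g) - L2_inner f g + of_real ((L2_norm g)\<^sup>2))"
    by (rule arg_cong)
  then show ?thesis by simp
qed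

lemma L2_Cauchy_Schwarz:
  assumes "f \<in> L2" "g \<in> L2"
  shows "cmod (L2_inner f g) \<le> L2_norm f * L2_norm g"
proof -
  have [measurable]: "f \<in> borel_measurable borel" "g \<in> borel_measurable borel"
    using assms by (simp_all add: L2_measurable)
  define I where "I = (\<integral> x. cmod (f x) * cmod (g x) \<partial>lborel)"
  have int: "integrable lborel (\<lambda>x. cmod (f x) * cmod (g x))"
    using integrable_norm[OF L2_integrable_mult[OF assms]] by (simp add: norm_mult)
  have "I \<ge> 0" unfolding I_def by simp
  have nn: "(\<integral>\<^sup>+ x. (ennreal (cmod (h x)))\<^sup>2 \<partial>lborel) = ennreal ((L2_norm h)\<^sup>2)" if "h \<in> L2" for h
    using L2_integrable[OF that] by (simp add: ennreal_power nn_integral_eq_integral L2_norm_def)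
  have "ennreal (I\<^sup>2) = (\<integral>\<^sup>+ x. ennreal (cmod (f x)) * ennreal (cmod (g x)) \<partial>lborel)\<^sup>2"
    using int \<open>I \<ge> 0\<close> unfolding I_def
    by (simp flip: ennreal_mult ennreal_power add: nn_integral_eq_integral)
  also have "\<dots> \<le> (\<integral>\<^sup>+ x. (ennreal (cmod (f x)))\<^sup>2 \<partial>lborel) * (\<integral>\<^sup>+ x. (ennreal (cmod (g x)))\<^sup>2 \<partial>lborel)"
    by (rule Cauchy_Schwarz_nn_integral) measurable
  also have "\<dots> = ennreal ((L2_norm f * L2_norm g)\<^sup>2)"
    using assms by (simp add: nn power_mult_distrib ennreal_mult)
  finally have "I\<^sup>2 \<le> (L2_norm f * L2_norm g)\<^sup>2" by simp
  then have "I \<le> L2_norm f * L2_norm g" by (rule power2_le_imp_le) simp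
  moreover have "cmod (L2_inner f g) \<le> I"
    unfolding L2_inner_def I_def using integral_norm_bound[of lborel "\<lambda>x. f x * cnj (g x)"]
    by (simp add: norm_mult)
  ultimately show ?thesis by simp
qed

lemma L2_norm_triangle_diff:
  assumes "f \<in> L2" "g \<in> L2"
  shows "L2_norm (\<lambda>x. f x - g x) \<le> L2_norm f + L2_norm g"
proof -
  have "(L2_norm (\<lambda>x. f x - g x))\<^sup>2 \<le> (L2_norm f + L2_norm g)\<^sup>2"
    using L2_Cauchy_Schwarz[OF assms] abs_Re_le_cmod[of "L2_inner f g"]
    by (simp add: L2_norm_diff_square[OF assms] power2_sum)
  then show ?thesis by (rule power2_le_imp_le) simp
qed

lemma L2_norm_scale: "L2_norm (\<lambda>x. c * f x) = cmod c * L2_norm f"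
  by (simp add: L2_norm_def norm_mult power_mult_distrib real_sqrt_mult)

lemma L2_norm_triangle:
  assumes "f \<in> L2" "g \<in> L2"
  shows "L2_norm (\<lambda>x. f x + g x) \<le> L2_norm f + L2_norm g"
  using L2_norm_triangle_diff[OF assms(1) L2_scale[OF assms(2), of "-1"]] L2_norm_scale[of "-1" g]
  by simp

lemma L2_norm_minus_commute: "L2_norm (\<lambda>x. f x - g x) = L2_norm (\<lambda>x. g x - f x)"
  by (simp add: L2_norm_def norm_minus_commute)

lemma abs_L2_norm_diff_le:
  assumes "f \<in> L2" "g \<in> L2"
  shows "\<bar>L2_norm f - L2_norm g\<bar> \<le> L2_norm (\<lambda>x. f x - g x)"
  using L2_norm_triangle[OF L2_diff[OF assms] assms(2)]
    L2_norm_triangle[OF L2_diff[OF assms(2,1)] assms(1)] L2_norm_minus_commute[of f g]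
  by simp

lemma L2_AE_cong:
  assumes "f \<in> L2" "g \<in> borel_measurable borel" "AE x in lborel. f x = g x"
  shows "g \<in> L2"
proof -
  have "integrable lborel (\<lambda>x. (cmod (g x))\<^sup>2)"
    using L2_integrable[OF assms(1)] assms
    by (subst integrable_cong_AE[where g = "\<lambda>x. (cmod (f x))\<^sup>2"]) (auto dest: L2_measurable elim: eventually_mono)
  then show ?thesis using assms(2) by (simp add: L2_def)
qed

lemma L2_norm_AE_cong:
  assumes "f \<in> borel_measurable borel" "g \<in> borel_measurable borel" "AE x in lborel. f x = g x"
  shows "L2_norm f = L2_norm g"
  unfolding L2_norm_def using assms
  by (intro arg_cong[where f = sqrt] integral_cong_AE) (auto elim: eventually_mono)

section \<open>Closure in \<open>L2\<close>\<close>

lemma L2_closureI: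
  "f \<in> L2 \<Longrightarrow> (\<And>e. e > 0 \<Longrightarrow> \<exists>g\<in>A. L2_norm (\<lambda>x. f x - g x) < e) \<Longrightarrow> f \<in> L2_closure A"
  by (simp add: L2_closure_def fun_diff_def)

lemma L2_closureE:
  assumes "f \<in> L2_closure A" "e > 0"
  obtains g where "g \<in> A" "L2_norm (\<lambda>x. f x - g x) < e"
  using assms by (auto simp: L2_closure_def fun_diff_def)

lemma L2_closure_subset_L2: "L2_closure A \<subseteq> L2"
  by (auto simp: L2_closure_def)

lemma L2_closure_superset:
  assumes "A \<subseteq> L2"
  shows "A \<subseteq> L2_closure A"
proof
  fix f assume "f \<in> A"
  then show "f \<in> L2_closure A"
    using assms by (intro L2_closureI bexI[of _ f]) (auto simp: L2_norm_def)
qed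

lemma L2_closure_idem:
  assumes "A \<subseteq> L2"
  shows "L2_closure (L2_closure A) = L2_closure A"
proof
  show "L2_closure A \<subseteq> L2_closure (L2_closure A)"
    by (rule L2_closure_superset[OF L2_closure_subset_L2])
  show "L2_closure (L2_closure A) \<subseteq> L2_closure A"
  proof
    fix f assume f: "f \<in> L2_closure (L2_closure A)"
    then have fL: "f \<in> L2" using L2_closure_subset_L2 by blast
    show "f \<in> L2_closure A"
    proof (rule L2_closureI[OF fL])
      fix e :: real assume "e > 0"
      then have "e / 2 > 0" by simp
      obtain g where g: "g \<in> L2_closure A" "L2_norm (\<lambda>x. f x - g x) < e / 2"
        using L2_closureE[OF f \<open>e / 2 > 0\<close>] .
      obtain h where h: "h \<in> A" "L2_norm (\<lambda>x. g x - h x) < e / 2"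
        using L2_closureE[OF g(1) \<open>e / 2 > 0\<close>] .
      have gL: "g \<in> L2" and hL: "h \<in> L2" using g(1) h(1) assms L2_closure_subset_L2 by blast+
      have "L2_norm (\<lambda>x. f x - h x) < e"
        using L2_norm_triangle[OF L2_diff[OF fL gL] L2_diff[OF gL hL]] g(2) h(2) by simp
      then show "\<exists>g\<in>A. L2_norm (\<lambda>x. f x - g x) < e" using h(1) by blast
    qed
  qed
qed

lemma subspace_L2: "cfun.subspace L2"
  by (rule cfun.subspaceI) (auto simp: plus_fun_def zero_fun_def L2_zero L2_add L2_scale)

lemma subspace_L2_closure:
  assumes "cfun.subspace A" "A \<subseteq> L2"
  shows "cfun.subspace (L2_closure A)"
proof (rule cfun.subspaceI)
  show "0 \<in> L2_closure A"
    using L2_closure_superset[OF assms(2)] cfun.subspace_0[OF assms(1)] by blast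
next
  fix f g assume fg: "f \<in> L2_closure A" "g \<in> L2_closure A"
  then have L: "f \<in> L2" "g \<in> L2" using L2_closure_subset_L2 by blast+
  have "(\<lambda>x. f x + g x) \<in> L2_closure A"
  proof (rule L2_closureI[OF L2_add[OF L]])
    fix e :: real assume "e > 0"
    then have e: "e / 2 > 0" by simp
    obtain f' where f': "f' \<in> A" "L2_norm (\<lambda>x. f x - f' x) < e / 2" using L2_closureE[OF fg(1) e] .
    obtain g' where g': "g' \<in> A" "L2_norm (\<lambda>x. g x - g' x) < e / 2" using L2_closureE[OF fg(2) e] .
    have L': "f' \<in> L2" "g' \<in> L2" using f' g' assms(2) by blast+
    have "f' + g' \<in> A" using f' g' cfun.subspace_add[OF assms(1)] by blast
    moreover have "L2_norm (\<lambda>x. (f x + g x) - (f' + g') x) < e"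
      using L2_norm_triangle[OF L2_diff[OF L(1) L'(1)] L2_diff[OF L(2) L'(2)]] f'(2) g'(2)
      by (simp add: algebra_simps)
    ultimately show "\<exists>h\<in>A. L2_norm (\<lambda>x. (f x + g x) - h x) < e" by blast
  qed
  then show "f + g \<in> L2_closure A" by (simp add: plus_fun_def)
next
  fix c f assume f: "f \<in> L2_closure A"
  then have L: "f \<in> L2" using L2_closure_subset_L2 by blast
  show "(\<lambda>x. c * f x) \<in> L2_closure A"
  proof (rule L2_closureI[OF L2_scale[OF L]])
    fix e :: real assume "e > 0"
    \<comment> \<open>The added 1 covers c = 0 and yields the strict inequality.\<close>
    then have e: "e / (cmod c + 1) > 0" by (simp add: add_nonneg_pos)
    obtain g where g: "g \<in> A" "L2_norm (\<lambda>x. f x - g x) < e / (cmod c + 1)" using L2_closureE[OF f e] .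
    have "L2_norm (\<lambda>x. c * f x - c * g x) = cmod c * L2_norm (\<lambda>x. f x - g x)"
      by (simp flip: L2_norm_scale add: right_diff_distrib)
    also have "\<dots> \<le> cmod c * (e / (cmod c + 1))" using g(2) by (intro mult_left_mono) auto
    also have "\<dots> < e"
    proof -
      have "cmod c + 1 > 0" by (simp add: add_nonneg_pos)
      then show ?thesis using \<open>e > 0\<close> by (simp add: pos_divide_less_eq algebra_simps)
    qed
    finally show "\<exists>h\<in>A. L2_norm (\<lambda>x. c * f x - h x) < e"
      by (rule bexI[of _ "\<lambda>x. c * g x"]) (rule cfun.subspace_scale[OF assms(1) g(1)])
  qed
qed

section \<open>Invariance of Lebesgue measure under left translation\<close>

lemma nn_integral_heis_mult:
  fixes G :: "heis \<Rightarrow> ennreal"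
  assumes G [measurable]: "G \<in> borel_measurable borel"
  shows "(\<integral>\<^sup>+ z. G (heis_mult x z) \<partial>lborel) = (\<integral>\<^sup>+ z. G z \<partial>lborel)"
proof -
  obtain p q t where x: "x = (p, q, t)" by (cases x) auto
  have borel3: "borel = (borel \<Otimes>\<^sub>M (borel \<Otimes>\<^sub>M borel) :: heis measure)" by (simp add: borel_prod)
  have G3 [measurable]: "(\<lambda>(a, b, c). G (a, b, c)) \<in> borel_measurable (borel \<Otimes>\<^sub>M (borel \<Otimes>\<^sub>M borel))"
    using G unfolding borel3 by (simp add: split_def)
  have triple: "(\<integral>\<^sup>+ z. F z \<partial>lborel) = (\<integral>\<^sup>+ a. \<integral>\<^sup>+ b. \<integral>\<^sup>+ c. F (a, b, c) \<partial>lborel \<partial>lborel \<partial>lborel)"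
    if "(\<lambda>(a, b, c). F (a, b, c)) \<in> borel_measurable (borel \<Otimes>\<^sub>M (borel \<Otimes>\<^sub>M borel))" for F :: "heis \<Rightarrow> ennreal"
  proof -
    have "F \<in> borel_measurable borel" using that unfolding borel3 by (simp add: split_def)
    then show ?thesis
      using nn_integral_triple[of lborel lborel F lborel]
      by (simp add: lborel_prod lborel.sigma_finite_measure_axioms)
  qed
  have shift: "(\<integral>\<^sup>+ a. F (s + a) \<partial>lborel) = (\<integral>\<^sup>+ a. F a \<partial>lborel)"
    if [measurable]: "F \<in> borel_measurable borel" for F :: "real \<Rightarrow> ennreal" and s
    by (subst (2) nn_integral_real_affine[where c = 1 and t = s]) simp_all
  \<comment> \<open>Left translation shifts the third coordinate by an amount depending on the first
    two, so the innermost integral is freed of its shift before the outer ones.\<close>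
  have "(\<integral>\<^sup>+ z. G (heis_mult x z) \<partial>lborel) =
      (\<integral>\<^sup>+ a. \<integral>\<^sup>+ b. \<integral>\<^sup>+ c. G (p + a, q + b, t + (p * b - q * a) / 2 + c) \<partial>lborel \<partial>lborel \<partial>lborel)"
    by (subst triple) (simp_all add: x algebra_simps)
  also have "\<dots> = (\<integral>\<^sup>+ a. \<integral>\<^sup>+ b. \<integral>\<^sup>+ c. G (p + a, q + b, c) \<partial>lborel \<partial>lborel \<partial>lborel)"
    by (intro nn_integral_cong shift) measurable
  also have "\<dots> = (\<integral>\<^sup>+ a. \<integral>\<^sup>+ b. \<integral>\<^sup>+ c. G (p + a, b, c) \<partial>lborel \<partial>lborel \<partial>lborel)"
    by (intro nn_integral_cong shift[where F = "\<lambda>b. \<integral>\<^sup>+ c. G (_, b, c) \<partial>lborel"]) measurable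
  also have "\<dots> = (\<integral>\<^sup>+ a. \<integral>\<^sup>+ b. \<integral>\<^sup>+ c. G (a, b, c) \<partial>lborel \<partial>lborel \<partial>lborel)"
    by (rule shift[where F = "\<lambda>a. \<integral>\<^sup>+ b. \<integral>\<^sup>+ c. G (a, b, c) \<partial>lborel \<partial>lborel"]) measurable
  also have "\<dots> = (\<integral>\<^sup>+ z. G z \<partial>lborel)" by (rule triple[symmetric, OF G3])
  finally show ?thesis .
qed

lemma borel_measurable_heis_mult [measurable]: "heis_mult x \<in> borel_measurable borel"
  by (intro borel_measurable_continuous_onI continuous_intros)

text \<open>As an identity of measures the invariance transfers integrability and norms alike, which
  makes \<open>lreg\<close> isometric on \<open>L2\<close>.\<close>

lemma distr_heis_mult: "distr lborel borel (heis_mult x) = lborel"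
proof (rule measure_eqI)
  fix A assume "A \<in> sets (distr lborel borel (heis_mult x))"
  then have [measurable]: "A \<in> sets borel" by simp
  have "emeasure (distr lborel borel (heis_mult x)) A = (\<integral>\<^sup>+ z. indicator A z \<partial>distr lborel borel (heis_mult x))"
    by simp
  also have "\<dots> = (\<integral>\<^sup>+ z. indicator A (heis_mult x z) \<partial>lborel)"
    by (rule nn_integral_distr) measurable
  also have "\<dots> = (\<integral>\<^sup>+ z. indicator A z \<partial>lborel)" by (rule nn_integral_heis_mult) measurable
  finally show "emeasure (distr lborel borel (heis_mult x)) A = emeasure lborel A" by simp
qed simp

lemma lreg_L2:
  assumes f: "f \<in> L2"
  shows "lreg x f \<in> L2"
proof -
  have [measurable]: "f \<in> borel_measurable borel" using f by (rule L2_measurable)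
  have "integrable (distr lborel borel (heis_mult (heis_inv x))) (\<lambda>y. (cmod (f y))\<^sup>2)"
    unfolding distr_heis_mult using f by (rule L2_integrable)
  then show ?thesis
    unfolding L2_def lreg_def by (subst (asm) integrable_distr_eq) auto
qed

lemma L2_norm_lreg:
  assumes f: "f \<in> borel_measurable borel"
  shows "L2_norm (lreg x f) = L2_norm f"
proof -
  note f [measurable]
  have "(\<integral> y. (cmod (f y))\<^sup>2 \<partial>distr lborel borel (heis_mult (heis_inv x))) =
      (\<integral> y. (cmod (f (heis_mult (heis_inv x) y)))\<^sup>2 \<partial>lborel)"
    by (rule integral_distr) measurable
  then show ?thesis unfolding distr_heis_mult L2_norm_def lreg_def by simp
qed

lemma lreg_lreg: "lreg x (lreg y f) = lreg (heis_mult x y) f"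
  by (simp add: lreg_def heis_inv_mult heis_mult_assoc)

section \<open>The space generated by the sinc-type function\<close>

text \<open>The finite linear combinations before closing up: honest functions, for which values at
  lattice points make sense.\<close>

definition heis_span :: "(heis \<Rightarrow> complex) set" where
  "heis_span = cfun.span (range (\<lambda>x. lreg x heis_sinc))"

lemma lreg_heis_sinc: "lreg x heis_sinc = (\<lambda>z. of_real (heis_ker (heis_mult (heis_inv x) z)))"
  by (simp add: lreg_def heis_sinc_eq_ker)

text \<open>For y = x the integrand of \<open>nn_integral_heis_ker\<close> is the square of twice a
  translate, with integral 1/2 + 2/4 = 1; a quarter of this is the squared norm.\<close>

lemma heis_ker_square_integral:
  "has_bochner_integral lborel (\<lambda>z. (heis_ker (heis_mult (heis_inv x) z))\<^sup>2) (1/4)"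
proof -
  have "(\<integral>\<^sup>+ z. ennreal ((heis_ker (heis_mult (heis_inv x) z) + heis_ker (heis_mult (heis_inv x) z))\<^sup>2) \<partial>lborel) = ennreal 1"
    by (subst nn_integral_heis_ker) (simp add: heis_mult_inv)
  then have "has_bochner_integral lborel (\<lambda>z. (heis_ker (heis_mult (heis_inv x) z) + heis_ker (heis_mult (heis_inv x) z))\<^sup>2) 1"
    by (intro has_bochner_integral_nn_integral) auto
  from has_bochner_integral_mult_right[OF this, of "1/4"] show ?thesis
    by (simp add: power2_eq_square algebra_simps)
qed

lemma lreg_heis_sinc_L2: "lreg x heis_sinc \<in> L2"
  using heis_ker_square_integral[of x] by (simp add: L2_def lreg_heis_sinc has_bochner_integral_iff)

lemma L2_norm_lreg_heis_sinc: "L2_norm (lreg x heis_sinc) = 1/2"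
proof -
  have "L2_norm (lreg x heis_sinc) = sqrt (1/4)"
    using heis_ker_square_integral[of x] by (simp add: L2_norm_def lreg_heis_sinc has_bochner_integral_iff)
  then show ?thesis by (simp add: real_sqrt_divide)
qed

text \<open>Polarisation of \<open>nn_integral_heis_ker\<close>. The right-hand side is the value at
  y of the translate by x, so this is the reproducing property on generators.\<close>

lemma L2_inner_lreg_heis_sinc:
  "L2_inner (lreg x heis_sinc) (lreg y heis_sinc) = of_real (heis_ker (heis_mult (heis_inv x) y))"
proof -
  let ?a = "\<lambda>z. heis_ker (heis_mult (heis_inv x) z)" and ?b = "\<lambda>z. heis_ker (heis_mult (heis_inv y) z)"
  let ?k = "heis_ker (heis_mult (heis_inv x) y)"
  have "0 \<le> 1/2 + 2 * ?k"
    using abs_heis_ker_le[of "heis_mult (heis_inv x) y"] by linarith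
  then have "has_bochner_integral lborel (\<lambda>z. (?a z + ?b z)\<^sup>2) (1/2 + 2 * ?k)"
    by (intro has_bochner_integral_nn_integral nn_integral_heis_ker) auto
  from has_bochner_integral_diff[OF has_bochner_integral_diff[OF this heis_ker_square_integral[of x]] heis_ker_square_integral[of y]]
  have "has_bochner_integral lborel (\<lambda>z. 2 * (?a z * ?b z)) (2 * ?k)"
    by (simp add: power2_sum algebra_simps)
  from has_bochner_integral_mult_right[OF this, of "1/2"]
  have "has_bochner_integral lborel (\<lambda>z. ?a z * ?b z) ?k" by simp
  then have "(\<integral> z. of_real (?a z * ?b z) \<partial>lborel) = complex_of_real ?k"
    unfolding integral_complex_of_real by (simp add: has_bochner_integral_iff)
  then show ?thesis by (simp add: L2_inner_def lreg_heis_sinc)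
qed

section \<open>Identities on the algebraic span\<close>

lemma subspace_heis_span: "cfun.subspace heis_span"
  by (simp add: heis_span_def)

lemma lreg_heis_sinc_in_span: "lreg x heis_sinc \<in> heis_span"
  unfolding heis_span_def by (rule cfun.span_base) simp

lemma heis_span_subset_L2: "heis_span \<subseteq> L2"
  unfolding heis_span_def
  by (rule cfun.span_minimal) (auto simp: lreg_heis_sinc_L2 subspace_L2)

text \<open>Membership in \<open>L2\<close> is carried along because additivity of the inner product
  is derived from integrability.\<close>

lemma heis_span_induct [consumes 1, case_names zero gen add scale]:
  assumes "f \<in> heis_span"
    and zero: "P (\<lambda>x. 0)" and gen: "\<And>x. P (lreg x heis_sinc)"
    and add: "\<And>f g. f \<in> L2 \<Longrightarrow> g \<in> L2 \<Longrightarrow> P f \<Longrightarrow> P g \<Longrightarrow> P (\<lambda>x. f x + g x)"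
    and scale: "\<And>c f. f \<in> L2 \<Longrightarrow> P f \<Longrightarrow> P (\<lambda>x. c * f x)"
  shows "P f"
proof -
  have "f \<in> L2 \<and> P f"
    using assms(1) unfolding heis_span_def
  proof (rule cfun.span_induct)
    show "cfun.subspace {f. f \<in> L2 \<and> P f}"
      by (rule cfun.subspaceI)
        (auto simp: plus_fun_def zero_fun_def L2_zero L2_add L2_scale zero add scale)
  qed (auto simp: lreg_heis_sinc_L2 gen)
  then show ?thesis ..
qed

lemma heis_span_sum: "(\<lambda>x. \<Sum>i\<in>I. c i * lreg (u i) heis_sinc x) \<in> heis_span"
proof (induction I rule: infinite_finite_induct)
  case (insert i I)
  have "(\<lambda>x. c i * lreg (u i) heis_sinc x) + (\<lambda>x. \<Sum>i\<in>I. c i * lreg (u i) heis_sinc x) \<in> heis_span"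
    by (intro cfun.subspace_add cfun.subspace_scale subspace_heis_span lreg_heis_sinc_in_span insert.IH)
  then show ?case using insert.hyps by (simp add: plus_fun_def)
qed (use cfun.subspace_0[OF subspace_heis_span] in \<open>simp_all add: zero_fun_def\<close>)

lemma heis_span_reproducing:
  assumes "f \<in> heis_span"
  shows "L2_inner f (lreg x heis_sinc) = f x"
  using assms
proof (induction rule: heis_span_induct)
  case zero
  then show ?case by (simp add: L2_inner_def)
next
  case (gen y)
  then show ?case unfolding L2_inner_lreg_heis_sinc by (simp add: lreg_heis_sinc)
qed (simp_all add: L2_inner_add_left L2_inner_scale_left lreg_heis_sinc_L2)

lemma heis_span_continuous:
  assumes "f \<in> heis_span"
  shows "continuous_on UNIV f"
  using assms
proof (induction rule: heis_span_induct)
  case (gen y)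
  show ?case
    unfolding lreg_heis_sinc
    by (intro continuous_intros continuous_on_compose2[OF continuous_on_heis_ker]) auto
qed (auto intro!: continuous_intros)

text \<open>The same polarisation as for the integral, now over the lattice. Both give the same
  kernel value, so summation over the lattice computes the inner product.\<close>

lemma lattice_sum_lreg_heis_sinc:
  "((\<lambda>\<gamma>. lreg x heis_sinc \<gamma> * cnj (lreg y heis_sinc \<gamma>)) has_sum
    L2_inner (lreg x heis_sinc) (lreg y heis_sinc)) heis_lattice"
proof -
  let ?a = "\<lambda>x z. heis_ker (heis_mult (heis_inv x) z)"
  have sum: "((\<lambda>\<gamma>. (?a x \<gamma> + ?a y \<gamma>)\<^sup>2) has_sum (1/2 + 2 * ?a x y)) heis_lattice" for x y
    using abs_heis_ker_le[of "heis_mult (heis_inv x) y"]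
    by (subst has_sum_iff_nn_integral_count_space) (simp_all add: lattice_sum_heis_ker)
  have square: "((\<lambda>\<gamma>. (?a x \<gamma>)\<^sup>2) has_sum (1/4)) heis_lattice" for x
    using has_sum_cmult_right[OF sum[of x x], of "1/4"]
    by (simp add: heis_mult_inv power2_eq_square algebra_simps)
  have "((\<lambda>\<gamma>. 1/2 * ((?a x \<gamma> + ?a y \<gamma>)\<^sup>2 + -1 * (?a x \<gamma>)\<^sup>2 + -1 * (?a y \<gamma>)\<^sup>2)) has_sum
      1/2 * ((1/2 + 2 * ?a x y) + -1 * (1/4) + -1 * (1/4))) heis_lattice"
    by (intro has_sum_cmult_right has_sum_add sum square)
  then have "((\<lambda>\<gamma>. ?a x \<gamma> * ?a y \<gamma>) has_sum ?a x y) heis_lattice"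
    by (simp add: power2_sum algebra_simps)
  from has_sum_of_real[OF this] show ?thesis
    unfolding L2_inner_lreg_heis_sinc by (simp add: lreg_heis_sinc)
qed

text \<open>Sesquilinearity reduces the claim to two translates, hence the induction on f inside the
  generator case of the induction on g.\<close>

lemma heis_span_lattice_sum:
  assumes f: "f \<in> heis_span" and g: "g \<in> heis_span"
  shows "((\<lambda>\<gamma>. f \<gamma> * cnj (g \<gamma>)) has_sum L2_inner f g) heis_lattice"
  using g
proof (induction rule: heis_span_induct)
  case zero
  show ?case by (simp add: L2_inner_def)
next
  case (gen y)
  show ?case using f
  proof (induction rule: heis_span_induct)
    case zero
    show ?case by (simp add: L2_inner_def)
  next
    case (gen x)
    show ?case by (rule lattice_sum_lreg_heis_sinc)
  next
    case (add f1 f2)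
    then show ?case
      using has_sum_add[OF add.IH] by (simp add: L2_inner_add_left lreg_heis_sinc_L2 ring_distribs)
  next
    case (scale c f)
    then show ?case using has_sum_cmult_right[OF scale.IH, of c] by (simp add: L2_inner_scale_left mult.assoc)
  qed
next
  case (add g1 g2)
  moreover have "f \<in> L2" using f heis_span_subset_L2 by blast
  ultimately show ?case
    using has_sum_add[OF add.IH] by (simp add: L2_inner_add_right ring_distribs)
next
  case (scale c g)
  then show ?case using has_sum_cmult_right[OF scale.IH, of "cnj c"]
    by (simp add: L2_inner_scale_right mult_ac)
qed

text \<open>A substitute for the point value that does not depend on the representative. On
  \<open>heis_span\<close> it is the value itself; on the closure it turns out to be the continuous
  representative.\<close>

definition heis_coeff :: "(heis \<Rightarrow> complex) \<Rightarrow> heis \<Rightarrow> complex" where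
  "heis_coeff f x = L2_inner f (lreg x heis_sinc)"

lemma heis_coeff_diff:
  "f \<in> L2 \<Longrightarrow> g \<in> L2 \<Longrightarrow> heis_coeff (\<lambda>x. f x - g x) y = heis_coeff f y - heis_coeff g y"
  by (simp add: heis_coeff_def L2_inner_diff_left lreg_heis_sinc_L2)

lemma norm_heis_coeff_le:
  assumes "f \<in> L2"
  shows "cmod (heis_coeff f x) \<le> L2_norm f"
proof -
  have "cmod (heis_coeff f x) \<le> L2_norm f * (1/2)"
    using L2_Cauchy_Schwarz[OF assms lreg_heis_sinc_L2[of x]]
    by (simp add: heis_coeff_def L2_norm_lreg_heis_sinc)
  then show ?thesis using L2_norm_nonneg[of f] by linarith
qed

lemma heis_span_tight:
  assumes f: "f \<in> heis_span"
  shows "((\<lambda>\<gamma>. (cmod (heis_coeff f \<gamma>))\<^sup>2) has_sum (L2_norm f)\<^sup>2) heis_lattice"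
proof -
  have "((\<lambda>\<gamma>. complex_of_real ((cmod (heis_coeff f \<gamma>))\<^sup>2)) has_sum of_real ((L2_norm f)\<^sup>2)) heis_lattice"
    using heis_span_lattice_sum[OF f f] unfolding L2_inner_self heis_coeff_def heis_span_reproducing[OF f]
    by (simp add: complex_norm_square del: of_real_power)
  then show ?thesis unfolding has_sum_of_real_iff .
qed

section \<open>Extension to the closed span\<close>

abbreviation heis_space :: "(heis \<Rightarrow> complex) set" where
  "heis_space \<equiv> L2_closure heis_span"

lemma subspace_heis_space: "cfun.subspace heis_space"
  by (rule subspace_L2_closure[OF subspace_heis_span heis_span_subset_L2])

lemma heis_space_L2: "f \<in> heis_space \<Longrightarrow> f \<in> L2"
  using L2_closure_subset_L2 by blast

lemma heis_span_space: "f \<in> heis_span \<Longrightarrow> f \<in> heis_space"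
  using L2_closure_superset[OF heis_span_subset_L2] by blast

lemma heis_space_diff: "f \<in> heis_space \<Longrightarrow> g \<in> heis_space \<Longrightarrow> (\<lambda>x. f x - g x) \<in> heis_space"
  using cfun.subspace_diff[OF subspace_heis_space] by (simp add: fun_diff_def)

lemma abs_L2_set_norm_diff_le:
  fixes u v :: "'i \<Rightarrow> 'b::real_normed_vector"
  shows "\<bar>L2_set (\<lambda>i. norm (u i)) A - L2_set (\<lambda>i. norm (v i)) A\<bar> \<le> L2_set (\<lambda>i. norm (u i - v i)) A"
proof -
  have *: "L2_set (\<lambda>i. norm (u i)) A \<le> L2_set (\<lambda>i. norm (v i)) A + L2_set (\<lambda>i. norm (u i - v i)) A"
    for u v :: "'i \<Rightarrow> 'b"
  proof -
    have "L2_set (\<lambda>i. norm (u i)) A \<le> L2_set (\<lambda>i. norm (v i) + norm (u i - v i)) A"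
      by (rule L2_set_mono) (use norm_triangle_sub in auto)
    also have "\<dots> \<le> L2_set (\<lambda>i. norm (v i)) A + L2_set (\<lambda>i. norm (u i - v i)) A"
      by (rule L2_set_triangle_ineq)
    finally show ?thesis .
  qed
  show ?thesis
    using *[of u v] *[of v u] by (simp add: norm_minus_commute)
qed

lemma heis_space_Bessel:
  assumes f: "f \<in> heis_space" and F: "finite F" "F \<subseteq> heis_lattice"
  shows "L2_set (\<lambda>\<gamma>. cmod (heis_coeff f \<gamma>)) F \<le> L2_norm f"
proof (rule field_le_epsilon)
  fix e :: real assume "e > 0"
  \<comment> \<open>The approximation costs at most d in the norm and at most d in each of the
    \<open>card F\<close> coefficients, together e.\<close>
  define d where "d = e / (1 + card F)"
  have "d > 0" using \<open>e > 0\<close> by (simp add: d_def)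
  obtain g where g: "g \<in> heis_span" "L2_norm (\<lambda>x. f x - g x) < d"
    using L2_closureE[OF f \<open>d > 0\<close>] .
  have L: "f \<in> L2" "g \<in> L2" using f g heis_space_L2 heis_span_subset_L2 by blast+
  have "L2_set (\<lambda>\<gamma>. cmod (heis_coeff f \<gamma>)) F \<le> L2_set (\<lambda>\<gamma>. cmod (heis_coeff g \<gamma>)) F
      + L2_set (\<lambda>\<gamma>. cmod (heis_coeff f \<gamma> - heis_coeff g \<gamma>)) F"
    using abs_L2_set_norm_diff_le[of "heis_coeff f" F "heis_coeff g"] by linarith
  also have "L2_set (\<lambda>\<gamma>. cmod (heis_coeff g \<gamma>)) F \<le> L2_norm g"
  proof -
    have "(\<Sum>\<gamma>\<in>F. (cmod (heis_coeff g \<gamma>))\<^sup>2) \<le> (L2_norm g)\<^sup>2"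
      using finite_sum_le_has_sum[OF heis_span_tight[OF g(1)] F] by simp
    then show ?thesis unfolding L2_set_def by (intro real_le_lsqrt) (auto intro: sum_nonneg)
  qed
  also have "L2_norm g \<le> L2_norm f + d"
    using abs_L2_norm_diff_le[OF L] g(2) by linarith
  also have "L2_set (\<lambda>\<gamma>. cmod (heis_coeff f \<gamma> - heis_coeff g \<gamma>)) F \<le> card F * d"
  proof -
    have "L2_set (\<lambda>\<gamma>. cmod (heis_coeff f \<gamma> - heis_coeff g \<gamma>)) F \<le> (\<Sum>\<gamma>\<in>F. cmod (heis_coeff f \<gamma> - heis_coeff g \<gamma>))"
      by (rule L2_set_le_sum) simp
    also have "\<dots> \<le> card F * d"
      unfolding heis_coeff_diff[OF L, symmetric]
      by (rule sum_bounded_above) (rule order_trans[OF norm_heis_coeff_le[OF L2_diff[OF L]] less_imp_le[OF g(2)]])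
    finally show ?thesis .
  qed
  also have "L2_norm f + d + card F * d = L2_norm f + e"
  proof -
    have "1 + real (card F) > 0" by (simp add: add_pos_nonneg)
    then have "(1 + card F) * d = e" by (simp add: d_def)
    then show ?thesis by (simp add: algebra_simps)
  qed
  finally show "L2_set (\<lambda>\<gamma>. cmod (heis_coeff f \<gamma>)) F \<le> L2_norm f + e" by simp
qed

text \<open>A three-epsilon argument; Bessel's inequality for f - g bounds the deviation of the
  partial sums uniformly in the finite set.\<close>

lemma heis_space_tight:
  assumes f: "f \<in> heis_space"
  shows "((\<lambda>\<gamma>. (cmod (heis_coeff f \<gamma>))\<^sup>2) has_sum (L2_norm f)\<^sup>2) heis_lattice"
proof -
  let ?l = "\<lambda>f F. L2_set (\<lambda>\<gamma>. cmod (heis_coeff f \<gamma>)) F"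
  have "(?l f \<longlongrightarrow> L2_norm f) (finite_subsets_at_top heis_lattice)"
  proof (rule tendstoI)
    fix e :: real assume "e > 0"
    then have "e / 3 > 0" by simp
    obtain g where g: "g \<in> heis_span" "L2_norm (\<lambda>x. f x - g x) < e / 3"
      using L2_closureE[OF f \<open>e / 3 > 0\<close>] .
    have gH: "g \<in> heis_space" using g(1) by (rule heis_span_space)
    have L: "f \<in> L2" "g \<in> L2" using f gH heis_space_L2 by blast+
    have "((\<lambda>F. sqrt (\<Sum>\<gamma>\<in>F. (cmod (heis_coeff g \<gamma>))\<^sup>2)) \<longlongrightarrow> sqrt ((L2_norm g)\<^sup>2)) (finite_subsets_at_top heis_lattice)"
      using heis_span_tight[OF g(1)] unfolding has_sum_def by (rule tendsto_real_sqrt)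
    then have "(?l g \<longlongrightarrow> L2_norm g) (finite_subsets_at_top heis_lattice)"
      by (simp add: L2_set_def[abs_def])
    then have "\<forall>\<^sub>F F in finite_subsets_at_top heis_lattice. dist (?l g F) (L2_norm g) < e / 3"
      using \<open>e / 3 > 0\<close> by (rule tendstoD)
    moreover have "\<forall>\<^sub>F F in finite_subsets_at_top heis_lattice. finite F \<and> F \<subseteq> heis_lattice"
      by (rule eventually_finite_subsets_at_top_weakI) simp
    ultimately show "\<forall>\<^sub>F F in finite_subsets_at_top heis_lattice. dist (?l f F) (L2_norm f) < e"
    proof eventually_elim
      case (elim F)
      have "\<bar>?l f F - ?l g F\<bar> \<le> ?l (\<lambda>x. f x - g x) F"
        unfolding heis_coeff_diff[OF L] by (rule abs_L2_set_norm_diff_le)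
      also have "\<dots> \<le> L2_norm (\<lambda>x. f x - g x)"
        by (rule heis_space_Bessel) (use elim f gH heis_space_diff in auto)
      finally show ?case
        using elim(1) g(2) abs_L2_norm_diff_le[OF L] unfolding dist_real_def by linarith
    qed
  qed
  then have "((\<lambda>F. (?l f F)\<^sup>2) \<longlongrightarrow> (L2_norm f)\<^sup>2) (finite_subsets_at_top heis_lattice)"
    by (rule tendsto_power)
  then show ?thesis by (simp add: has_sum_def L2_set_def sum_nonneg)
qed

text \<open>Let s be the partial sum of squares and g the partial expansion. Expanding the square
  gives the squared norm of f, minus 2 s, plus the squared norm of g. As the translates are not
  orthonormal, the last term is only bounded by s: it pairs the coefficients of f with those of g,
  so Cauchy-Schwarz and Bessel's inequality for g give \<open>L2_norm g\<close> <= sqrt s.\<close>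

lemma heis_expansion_remainder:
  assumes f: "f \<in> heis_space" and F: "finite F" "F \<subseteq> heis_lattice"
  shows "(L2_norm (\<lambda>x. f x - (\<Sum>\<gamma>\<in>F. heis_coeff f \<gamma> * lreg \<gamma> heis_sinc x)))\<^sup>2
    \<le> (L2_norm f)\<^sup>2 - (\<Sum>\<gamma>\<in>F. (cmod (heis_coeff f \<gamma>))\<^sup>2)"
proof -
  define g where "g = (\<lambda>x. \<Sum>\<gamma>\<in>F. heis_coeff f \<gamma> * lreg \<gamma> heis_sinc x)"
  define s where "s = (\<Sum>\<gamma>\<in>F. (cmod (heis_coeff f \<gamma>))\<^sup>2)"
  have gH: "g \<in> heis_space" unfolding g_def by (intro heis_span_space heis_span_sum)
  have L: "f \<in> L2" "g \<in> L2" using f gH heis_space_L2 by blast+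
  have inner: "L2_inner g h = (\<Sum>\<gamma>\<in>F. heis_coeff f \<gamma> * cnj (heis_coeff h \<gamma>))" if "h \<in> L2" for h
    unfolding g_def heis_coeff_def
    by (subst L2_inner_sum_left) (auto intro: L2_scale lreg_heis_sinc_L2 that simp: L2_inner_scale_left L2_inner_commute[of _ h])
  have "Re (L2_inner f g) = s"
    unfolding s_def using inner[OF L(1)]
    by (subst L2_inner_commute) (simp add: complex_norm_square[symmetric])
  moreover have "(L2_norm g)\<^sup>2 \<le> s"
  proof -
    have "(L2_norm g)\<^sup>2 = cmod (L2_inner g g)"
      unfolding L2_inner_self norm_of_real by simp
    also have "\<dots> \<le> (\<Sum>\<gamma>\<in>F. \<bar>cmod (heis_coeff f \<gamma>)\<bar> * \<bar>cmod (heis_coeff g \<gamma>)\<bar>)"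
      unfolding inner[OF L(2)] by (rule order_trans[OF norm_sum]) (simp add: norm_mult)
    also have "\<dots> \<le> L2_set (\<lambda>\<gamma>. cmod (heis_coeff f \<gamma>)) F * L2_set (\<lambda>\<gamma>. cmod (heis_coeff g \<gamma>)) F"
      by (rule L2_set_mult_ineq)
    also have "\<dots> \<le> sqrt s * L2_norm g"
      unfolding s_def L2_set_def[of "\<lambda>\<gamma>. cmod (heis_coeff f \<gamma>)", symmetric]
      by (intro mult_left_mono heis_space_Bessel gH F) (simp add: L2_set_nonneg)
    finally have "L2_norm g * L2_norm g \<le> sqrt s * L2_norm g" by (simp add: power2_eq_square)
    moreover have "s \<ge> 0" unfolding s_def by (simp add: sum_nonneg)
    ultimately have "L2_norm g \<le> sqrt s"
      using L2_norm_nonneg[of g] by (cases "L2_norm g = 0") (auto simp: mult_le_cancel_right)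
    then have "(L2_norm g)\<^sup>2 \<le> (sqrt s)\<^sup>2" by (rule power_mono) simp
    then show ?thesis using \<open>s \<ge> 0\<close> by simp
  qed
  ultimately show ?thesis
    using L2_norm_diff_square[OF L] unfolding g_def s_def by simp
qed

text \<open>Elements of the span are continuous and equal their own coefficients, and coefficients
  of functions that are close in \<open>L2\<close> are uniformly close.\<close>

lemma continuous_on_heis_coeff:
  assumes f: "f \<in> heis_space"
  shows "continuous_on UNIV (heis_coeff f)"
proof -
  have "\<exists>g. g \<in> heis_span \<and> L2_norm (\<lambda>x. f x - g x) < 1 / real (Suc n)" for n
    using L2_closureE[OF f, of "1 / real (Suc n)"] by fastforce
  then obtain g where g: "\<And>n. g n \<in> heis_span" "\<And>n. L2_norm (\<lambda>x. f x - g n x) < 1 / real (Suc n)"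
    by metis
  have L: "f \<in> L2" "g n \<in> L2" for n using f g heis_space_L2 heis_span_subset_L2 by blast+
  show ?thesis
  proof (rule uniform_limit_theorem)
    show "\<forall>\<^sub>F n in sequentially. continuous_on UNIV (g n)"
      using g(1) by (simp add: heis_span_continuous)
    show "uniform_limit UNIV g (heis_coeff f) sequentially"
    proof (rule uniform_limitI)
      fix e :: real assume "e > 0"
      then obtain N where N: "N > 0" "1 / real N < e"
        using real_arch_inverse[of e] by (auto simp: inverse_eq_divide)
      have "dist (g n x) (heis_coeff f x) < e" if "n \<ge> N" for n x
      proof -
        have "dist (g n x) (heis_coeff f x) = cmod (heis_coeff (\<lambda>x. f x - g n x) x)"
          unfolding heis_coeff_diff[OF L] using heis_span_reproducing[OF g(1)]
          by (simp add: dist_norm norm_minus_commute heis_coeff_def)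
        also have "\<dots> \<le> L2_norm (\<lambda>x. f x - g n x)" by (intro norm_heis_coeff_le L2_diff L)
        also have "\<dots> < 1 / real (Suc n)" by (rule g(2))
        also have "\<dots> \<le> 1 / real N" using that N(1) by (intro divide_left_mono) auto
        finally show ?thesis using N(2) by simp
      qed
      then show "\<forall>\<^sub>F n in sequentially. \<forall>x\<in>UNIV. dist (g n x) (heis_coeff f x) < e"
        unfolding eventually_sequentially by blast
    qed
  qed simp
qed

text \<open>Approximants from the span converge to f in \<open>L2\<close> and to its coefficients
  uniformly. On a ball, which has finite measure, the uniform error is small in \<open>L2\<close>
  too, so the two limits agree almost everywhere; countably many balls cover the group.\<close>

lemma heis_space_AE_coeff:
  assumes f: "f \<in> heis_space"
  shows "AE x in lborel. f x = heis_coeff f x"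
proof -
  have fL: "f \<in> L2" using f by (rule heis_space_L2)
  have [measurable]: "f \<in> borel_measurable borel" using fL by (rule L2_measurable)
  have [measurable]: "heis_coeff f \<in> borel_measurable borel"
    by (rule borel_measurable_continuous_onI[OF continuous_on_heis_coeff[OF f]])
  have "AE x in lborel. x \<in> ball 0 (real n) \<longrightarrow> f x = heis_coeff f x" for n
  proof -
    let ?B = "ball (0::heis) (real n)"
    let ?I = "\<integral>\<^sup>+ x. ennreal ((cmod (f x - heis_coeff f x))\<^sup>2) * indicator ?B x \<partial>lborel"
    have [measurable]: "?B \<in> sets borel" by simp
    \<comment> \<open>Collects the errors: 2 from the distance to g in \<open>L2\<close>, and twice
      the measure of the ball from the uniform distance; e is then chosen with K e^2 = d.\<close>
    define K where "K = 2 + 2 * measure lborel ?B"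
    have "K > 0" by (simp add: K_def add_pos_nonneg)
    have B: "emeasure lborel ?B = ennreal (measure lborel ?B)"
      by (rule emeasure_eq_ennreal_measure) (use emeasure_lborel_ball_finite[of "0::heis" "real n"] in auto)
    have "?I \<le> 0 + ennreal d" if "d > 0" for d
    proof -
      define e where "e = sqrt (d / K)"
      have "e > 0" using that \<open>K > 0\<close> by (simp add: e_def)
      obtain g where g: "g \<in> heis_span" "L2_norm (\<lambda>x. f x - g x) < e"
        using L2_closureE[OF f \<open>e > 0\<close>] .
      have gL: "g \<in> L2" using g(1) heis_span_subset_L2 by blast
      have [measurable]: "g \<in> borel_measurable borel" using gL by (rule L2_measurable)
      have "?I \<le> (\<integral>\<^sup>+ x. ennreal (2 * (cmod (f x - g x))\<^sup>2) + ennreal (2 * e\<^sup>2) * indicator ?B x \<partial>lborel)"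
      proof (rule nn_integral_mono)
        fix x
        have "cmod (g x - heis_coeff f x) = cmod (heis_coeff (\<lambda>x. f x - g x) x)"
          unfolding heis_coeff_diff[OF fL gL] using heis_span_reproducing[OF g(1)]
          by (simp add: norm_minus_commute heis_coeff_def)
        also have "\<dots> \<le> e"
          using norm_heis_coeff_le[OF L2_diff[OF fL gL], of x] g(2) by linarith
        finally have "cmod (f x - heis_coeff f x) \<le> cmod (f x - g x) + e"
          using norm_triangle_ineq[of "f x - g x" "g x - heis_coeff f x"] by simp
        then have "(cmod (f x - heis_coeff f x))\<^sup>2 \<le> (cmod (f x - g x) + e)\<^sup>2"
          by (rule power_mono) simp
        also have "\<dots> \<le> 2 * (cmod (f x - g x))\<^sup>2 + 2 * e\<^sup>2"
          using sum_squares_bound[of "cmod (f x - g x)" e] by (simp add: power2_sum)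
        finally show "ennreal ((cmod (f x - heis_coeff f x))\<^sup>2) * indicator ?B x \<le>
            ennreal (2 * (cmod (f x - g x))\<^sup>2) + ennreal (2 * e\<^sup>2) * indicator ?B x"
          by (auto simp: indicator_def ennreal_plus[symmetric] simp del: ennreal_plus intro!: ennreal_leI)
      qed
      also have "\<dots> = (\<integral>\<^sup>+ x. ennreal (2 * (cmod (f x - g x))\<^sup>2) \<partial>lborel) + ennreal (2 * e\<^sup>2) * emeasure lborel ?B"
        by (subst nn_integral_add) (simp_all add: nn_integral_cmult_indicator)
      also have "(\<integral>\<^sup>+ x. ennreal (2 * (cmod (f x - g x))\<^sup>2) \<partial>lborel) = ennreal (2 * (L2_norm (\<lambda>x. f x - g x))\<^sup>2)"
        using L2_integrable[OF L2_diff[OF fL gL]]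
        by (subst nn_integral_eq_integral) (simp_all add: L2_norm_def)
      also have "\<dots> + ennreal (2 * e\<^sup>2) * emeasure lborel ?B
          = ennreal (2 * (L2_norm (\<lambda>x. f x - g x))\<^sup>2 + 2 * e\<^sup>2 * measure lborel ?B)"
        unfolding B by (simp add: ennreal_mult)
      also have "\<dots> \<le> ennreal d"
      proof (rule ennreal_leI)
        have "(L2_norm (\<lambda>x. f x - g x))\<^sup>2 \<le> e\<^sup>2" using g(2) by (intro power_mono) auto
        then have "2 * (L2_norm (\<lambda>x. f x - g x))\<^sup>2 + 2 * e\<^sup>2 * measure lborel ?B \<le> K * e\<^sup>2"
          by (simp add: K_def algebra_simps)
        also have "\<dots> = d" using that \<open>K > 0\<close> by (simp add: e_def)
        finally show "2 * (L2_norm (\<lambda>x. f x - g x))\<^sup>2 + 2 * e\<^sup>2 * measure lborel ?B \<le> d" .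
      qed
      finally show ?thesis by simp
    qed
    then have "?I \<le> 0" by (rule ennreal_le_epsilon)
    then have "?I = 0" by simp
    then have "AE x in lborel. ennreal ((cmod (f x - heis_coeff f x))\<^sup>2) * indicator ?B x = 0"
      by (subst (asm) nn_integral_0_iff_AE) measurable
    then show ?thesis by eventually_elim (auto simp: indicator_def)
  qed
  then have "AE x in lborel. \<forall>n. x \<in> ball 0 (real n) \<longrightarrow> f x = heis_coeff f x"
    unfolding AE_all_countable ..
  then show ?thesis
  proof eventually_elim
    case (elim x)
    obtain n where "norm x < real n" using reals_Archimedean2 by blast
    then show ?case using elim by auto
  qed
qed

text \<open>The set where the functions differ is open, and a nonempty open set is not null.\<close>

lemma continuous_AE_eq_imp_eq:
  fixes f g :: "'a::euclidean_space \<Rightarrow> 'b::real_normed_vector"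
  assumes "continuous_on UNIV f" "continuous_on UNIV g" and ae: "AE x in lborel. f x = g x"
  shows "f = g"
proof (rule ccontr)
  assume "f \<noteq> g"
  have op: "open {x. f x \<noteq> g x}"
    using assms(1,2) by (rule open_Collect_neq)
  then have "{x. f x \<noteq> g x} \<in> null_sets lborel"
    using ae by (subst AE_iff_null_sets) auto
  then have "negligible {x. f x \<noteq> g x}"
    by (simp add: negligible_iff_null_sets null_sets_completionI)
  then show False using open_not_negligible[OF op] \<open>f \<noteq> g\<close> by auto
qed

lemma cont_rep_heis_coeff:
  assumes "f \<in> cont_rep heis_space"
  shows "heis_coeff f = f"
  using assms heis_space_AE_coeff continuous_on_heis_coeff
  by (intro continuous_AE_eq_imp_eq) (auto simp: cont_rep_def eq_commute)

text \<open>Norms ignore null sets, so the functions that approximate f also approximate its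
  coefficient function.\<close>

lemma heis_coeff_cont_rep:
  assumes f: "f \<in> heis_space"
  shows "heis_coeff f \<in> cont_rep heis_space"
proof -
  have fL: "f \<in> L2" using f by (rule heis_space_L2)
  have m [measurable]: "heis_coeff f \<in> borel_measurable borel"
    by (rule borel_measurable_continuous_onI[OF continuous_on_heis_coeff[OF f]])
  have ae: "AE x in lborel. f x = heis_coeff f x" using f by (rule heis_space_AE_coeff)
  have "heis_coeff f \<in> heis_space"
  proof (rule L2_closureI[OF L2_AE_cong[OF fL m ae]])
    fix e :: real assume "e > 0"
    then obtain g where g: "g \<in> heis_span" "L2_norm (\<lambda>x. f x - g x) < e" by (rule L2_closureE[OF f])
    have [measurable]: "f \<in> borel_measurable borel" "g \<in> borel_measurable borel"
      using fL g(1) heis_span_subset_L2 by (auto dest: L2_measurable)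
    have "L2_norm (\<lambda>x. heis_coeff f x - g x) = L2_norm (\<lambda>x. f x - g x)"
      by (rule L2_norm_AE_cong) (use ae in \<open>auto elim: eventually_mono\<close>)
    then have "L2_norm (\<lambda>x. heis_coeff f x - g x) < e" using g(2) by simp
    then show "\<exists>g\<in>heis_span. L2_norm (\<lambda>x. heis_coeff f x - g x) < e" using g(1) by (rule bexI)
  qed
  then show ?thesis by (simp add: cont_rep_def continuous_on_heis_coeff[OF f])
qed

section \<open>Left invariance and the sampling expansion\<close>

lemma lreg_heis_span:
  assumes "f \<in> heis_span"
  shows "lreg x f \<in> heis_span"
  using assms
proof (induction rule: heis_span_induct)
  case zero
  show ?case using cfun.subspace_0[OF subspace_heis_span] by (simp add: lreg_def zero_fun_def)
next
  case (gen y)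
  show ?case by (simp add: lreg_lreg lreg_heis_sinc_in_span)
next
  case (add f g)
  then show ?case using cfun.subspace_add[OF subspace_heis_span add.IH] by (simp add: lreg_def plus_fun_def)
next
  case (scale c f)
  then show ?case using cfun.subspace_scale[OF subspace_heis_span scale.IH] by (simp add: lreg_def)
qed

lemma lreg_heis_space:
  assumes f: "f \<in> heis_space"
  shows "lreg x f \<in> heis_space"
proof (rule L2_closureI)
  have fL: "f \<in> L2" using f by (rule heis_space_L2)
  then show "lreg x f \<in> L2" by (rule lreg_L2)
  fix e :: real assume "e > 0"
  then obtain g where g: "g \<in> heis_span" "L2_norm (\<lambda>x. f x - g x) < e" by (rule L2_closureE[OF f])
  have "g \<in> L2" using g(1) heis_span_subset_L2 by blast
  then have "L2_norm (lreg x (\<lambda>x. f x - g x)) = L2_norm (\<lambda>x. f x - g x)"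
    by (intro L2_norm_lreg L2_measurable L2_diff fL)
  then have "L2_norm (\<lambda>z. lreg x f z - lreg x g z) < e" using g(2) by (simp add: lreg_def)
  then show "\<exists>g\<in>heis_span. L2_norm (\<lambda>z. lreg x f z - g z) < e" using lreg_heis_span[OF g(1)] by blast
qed

lemma heis_sinc_eq_lreg: "heis_sinc = lreg (0, 0, 0) heis_sinc"
  by (simp add: lreg_def heis_mult_unit)

lemma heis_sinc_cont_rep: "heis_sinc \<in> cont_rep heis_space"
  unfolding cont_rep_def using lreg_heis_sinc_in_span[of "(0, 0, 0)"]
  by (simp flip: heis_sinc_eq_lreg add: heis_span_space heis_span_continuous)

text \<open>By the tight frame identity the bound on the remainder tends to 0.\<close>

lemma heis_expansion_tendsto:
  assumes f: "f \<in> heis_space"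
  shows "((\<lambda>F. L2_norm (\<lambda>x. f x - (\<Sum>\<gamma>\<in>F. heis_coeff f \<gamma> * lreg \<gamma> heis_sinc x))) \<longlongrightarrow> 0)
    (finite_subsets_at_top heis_lattice)"
proof (rule tendsto_sandwich[where f = "\<lambda>_. 0" and h = "\<lambda>F. sqrt ((L2_norm f)\<^sup>2 - (\<Sum>\<gamma>\<in>F. (cmod (heis_coeff f \<gamma>))\<^sup>2))"])
  let ?s = "\<lambda>F. \<Sum>\<gamma>\<in>F. (cmod (heis_coeff f \<gamma>))\<^sup>2"
  show "\<forall>\<^sub>F F in finite_subsets_at_top heis_lattice.
      L2_norm (\<lambda>x. f x - (\<Sum>\<gamma>\<in>F. heis_coeff f \<gamma> * lreg \<gamma> heis_sinc x)) \<le> sqrt ((L2_norm f)\<^sup>2 - ?s F)"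
    by (intro eventually_finite_subsets_at_top_weakI real_le_rsqrt heis_expansion_remainder f)
  have "((\<lambda>F. sqrt ((L2_norm f)\<^sup>2 - ?s F)) \<longlongrightarrow> sqrt ((L2_norm f)\<^sup>2 - (L2_norm f)\<^sup>2)) (finite_subsets_at_top heis_lattice)"
    using heis_space_tight[OF f] unfolding has_sum_def by (intro tendsto_intros)
  then show "((\<lambda>F. sqrt ((L2_norm f)\<^sup>2 - ?s F)) \<longlongrightarrow> 0) (finite_subsets_at_top heis_lattice)" by simp
qed simp_all

lemma sinc_type_function_heis_sinc: "sinc_type_function heis_lattice heis_space heis_sinc"
  unfolding sinc_type_function_def
proof (intro conjI ballI heis_sinc_cont_rep)
  fix f assume f: "f \<in> cont_rep heis_space"
  then have fH: "f \<in> heis_space" and cont: "continuous_on UNIV f" by (auto simp: cont_rep_def)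
  let ?g = "\<lambda>F x. \<Sum>\<gamma>\<in>F. f \<gamma> * heis_sinc (heis_mult (heis_inv \<gamma>) x)"
  have lim: "((\<lambda>F. L2_norm (\<lambda>x. f x - ?g F x)) \<longlongrightarrow> 0) (finite_subsets_at_top heis_lattice)"
    using heis_expansion_tendsto[OF fH] unfolding cont_rep_heis_coeff[OF f] lreg_def .
  then show "((\<lambda>F. L2_norm (\<lambda>x. f x - ?g F x)) \<longlongrightarrow> 0) (finite_subsets_at_top heis_lattice)" .
  \<comment> \<open>The remainder is itself continuous and lies in the space. It therefore equals
    its coefficient function, and its norm bounds it at every x.\<close>
  have le: "dist (?g F x) (f x) \<le> L2_norm (\<lambda>x. f x - ?g F x)" for F x
  proof -
    have g: "?g F \<in> heis_span"
      using heis_span_sum[of f "\<lambda>\<gamma>. \<gamma>" F] by (simp add: lreg_def)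
    have H: "(\<lambda>x. f x - ?g F x) \<in> heis_space" by (rule heis_space_diff[OF fH heis_span_space[OF g]])
    then have "(\<lambda>x. f x - ?g F x) \<in> cont_rep heis_space"
      unfolding cont_rep_def using cont heis_span_continuous[OF g] by (auto intro!: continuous_on_diff)
    from fun_cong[OF cont_rep_heis_coeff[OF this], of x]
    have "f x - ?g F x = heis_coeff (\<lambda>x. f x - ?g F x) x" by simp
    then show ?thesis
      using norm_heis_coeff_le[OF heis_space_L2[OF H], of x] by (simp add: dist_norm norm_minus_commute)
  qed
  show "uniform_limit UNIV ?g f (finite_subsets_at_top heis_lattice)"
  proof (rule uniform_limitI)
    fix e :: real assume "e > 0"
    have "\<forall>\<^sub>F F in finite_subsets_at_top heis_lattice. L2_norm (\<lambda>x. f x - ?g F x) < e"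
      by (rule order_tendstoD(2)[OF lim \<open>e > 0\<close>])
    then show "\<forall>\<^sub>F F in finite_subsets_at_top heis_lattice. \<forall>x\<in>UNIV. dist (?g F x) (f x) < e"
      by eventually_elim (use le le_less_trans in blast)
  qed
qed

lemma closed_left_invariant_heis_space: "closed_left_invariant_subspace heis_space"
  unfolding closed_left_invariant_subspace_def
  using L2_closure_subset_L2 subspace_heis_space L2_closure_idem[OF heis_span_subset_L2] lreg_heis_space
  by blast

lemma consists_of_continuous_heis_space: "consists_of_continuous heis_space"
  unfolding consists_of_continuous_def
  using heis_coeff_cont_rep heis_space_AE_coeff by blast

lemma sampling_identity_heis_space: "sampling_identity heis_lattice heis_space 1"
  unfolding sampling_identity_def
proof (intro conjI ballI)
  fix f assume f: "f \<in> cont_rep heis_space"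
  then have "f \<in> heis_space" by (simp add: cont_rep_def)
  from heis_space_tight[OF this]
  show "((\<lambda>\<gamma>. (cmod (f \<gamma>))\<^sup>2) has_sum 1 * (L2_norm f)\<^sup>2) heis_lattice"
    by (simp add: cont_rep_heis_coeff[OF f])
qed simp

theorem theorem8p1:
  fixes H :: "(heis \<Rightarrow> complex) set"
  assumes "H = left_invariant_generated heis_sinc"
  shows "heis_sinc \<in> L2 \<and>
         sampling_space heis_lattice H \<and>
         sampling_identity heis_lattice H 1 \<and>
         sinc_type_function heis_lattice H heis_sinc \<and>
         normalised_tight_frame heis_lattice (\<lambda>\<gamma>. lreg \<gamma> heis_sinc) H \<and>
         \<not> orthonormal_basis heis_lattice (\<lambda>\<gamma>. lreg \<gamma> heis_sinc) H \<and>
         L2_norm heis_sinc = 1 / 2"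
proof -
  have H: "H = heis_space" using assms by (simp add: left_invariant_generated_def heis_span_def)
  have "heis_sinc \<in> L2" using lreg_heis_sinc_L2[of "(0, 0, 0)"] by (simp flip: heis_sinc_eq_lreg)
  moreover have norm: "L2_norm heis_sinc = 1 / 2"
    using L2_norm_lreg_heis_sinc[of "(0, 0, 0)"] by (simp flip: heis_sinc_eq_lreg)
  moreover have "sampling_space heis_lattice H"
    unfolding H sampling_space_def
    using closed_left_invariant_heis_space consists_of_continuous_heis_space
      sampling_identity_heis_space sinc_type_function_heis_sinc by blast
  moreover have "normalised_tight_frame heis_lattice (\<lambda>\<gamma>. lreg \<gamma> heis_sinc) H"
    unfolding H normalised_tight_frame_def
    using heis_space_tight by (auto simp: heis_coeff_def lreg_heis_sinc_in_span heis_span_space)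
  moreover have "\<not> orthonormal_basis heis_lattice (\<lambda>\<gamma>. lreg \<gamma> heis_sinc) H"
  proof
    assume "orthonormal_basis heis_lattice (\<lambda>\<gamma>. lreg \<gamma> heis_sinc) H"
    \<comment> \<open>The diagonal entry at the neutral element would have to be 1, whereas it is
      the squared norm 1/4.\<close>
    moreover have "(0, 0, 0) \<in> heis_lattice" unfolding heis_lattice_def by force
    ultimately have "L2_inner heis_sinc heis_sinc = 1"
      unfolding orthonormal_basis_def by (metis heis_sinc_eq_lreg)
    then show False by (simp add: L2_inner_self norm power2_eq_square)
  qed
  ultimately show ?thesis
    unfolding H using sampling_identity_heis_space sinc_type_function_heis_sinc by blast
qed

end
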